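(* Let $G_m$ be a bounded Vilenkin group, let $p\in[1,+\infty]$, $0<\alpha<1$, and let $f\in L^p(G_m)$ satisfy $$M_k^{\alpha}\,\omega\left(1/M_{k-1},f\right)_p\to0\quad\text{as } k\to\infty .$$ Then $$\left\|\sigma_n^{-\alpha}(f)-f\right\|_p\to0\quad\text{as } n\to\infty .$$
   Context: Let $m=(m_0,m_1,\dots)$ be a fixed bounded sequence of integers $m_k\ge 2$, and $Z_{m_k}=\{0,1,\dots,m_k-1\}$ the additive group of integers modulo $m_k$ with the discrete topology. The bounded Vilenkin group $G_m$ is the complete direct product of the groups $Z_{m_k}$ ($k\in N=\{0,1,2,\dots\}$) with the product topology and coordinatewise addition; $\mu$ is its Haar measure with $\mu(G_m)=1$ (the product of the uniform probability measures on $Z_{m_k}$). Elements are written $x=(x_0,x_1,\dots)$, $x_j\in Z_{m_j}$. Put $I_0=G_m$ and $I_n=\{y\in G_m: y_0=\dots=y_{n-1}=0\}$ for $n\ge1$. Put $M_0=1$, $M_{k+1}=m_kM_k$; every $n\in N$ is uniquely $n=\sum_{j=0}^\infty n_jM_j$ with $n_j\in Z_{m_j}$, only finitely many $n_j$ nonzero. The generalized Rademacher functions are $r_k(x)=\exp(2\pi i x_k/m_k)$, and the Vilenkin system is $\psi_n(x)=\prod_{k=0}^\infty r_k(x)^{n_k}$, $n\in N$. Fourier coefficients: $\widehat f(k)=\int_{G_m} f\,\overline{\psi_k}\,d\mu$. For real $\beta$, $A_0^{\beta}=1$ and $A_n^{\beta}=\frac{(\beta+1)\cdots(\beta+n)}{n!}$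 for $n\ge1$. The Cesàro $(C,-\alpha)$ means of the Vilenkin-Fourier series of $f$ are $$\sigma_n^{-\alpha}(f,x)=\frac1{A_n^{-\alpha}}\sum_{k=0}^n A_{n-k}^{-\alpha}\widehat f(k)\psi_k(x).$$ For $1\le p<\infty$, $\|f\|_p=\left(\int_{G_m}|f|^p\,d\mu\right)^{1/p}$. By convention $L^\infty(G_m)$ denotes $C(G_m)$, the continuous functions on $G_m$ with the supremum norm $\|\cdot\|_\infty$. The modulus of continuity is $\omega(1/M_n,f)_p=\sup_{h\in I_n}\|f(\cdot+h)-f(\cdot)\|_p$. *)

theory Defs
  imports "HOL-Probability.Probability" "HOL-Algebra.Product_Groups"
begin

definition vilenkin_group :: "(nat \<Rightarrow> nat) \<Rightarrow> (nat \<Rightarrow> int) monoid" where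
  "vilenkin_group m = product_group UNIV (\<lambda>k. integer_mod_group (m k))"

definition vilenkin_topology :: "(nat \<Rightarrow> nat) \<Rightarrow> (nat \<Rightarrow> int) topology" where
  "vilenkin_topology m =
     product_topology (\<lambda>k. discrete_topology (carrier (integer_mod_group (m k)))) UNIV"

definition vilenkin_measure :: "(nat \<Rightarrow> nat) \<Rightarrow> (nat \<Rightarrow> int) measure" where
  "vilenkin_measure m = PiM UNIV (\<lambda>k. uniform_count_measure (carrier (integer_mod_group (m k))))"

definition vilenkin_I :: "(nat \<Rightarrow> nat) \<Rightarrow> nat \<Rightarrow> (nat \<Rightarrow> int) set" where
  "vilenkin_I m n = {y \<in> carrier (vilenkin_group m). \<forall>j<n. y j = 0}"

primrec vilenkin_M :: "(nat \<Rightarrow> nat) \<Rightarrow> nat \<Rightarrow> nat" where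
  "vilenkin_M m 0 = 1"
| "vilenkin_M m (Suc k) = m k * vilenkin_M m k"

text \<open>The coefficient of \<open>vilenkin_M m j\<close> in the mixed radix expansion of \<open>n\<close>; see the lemmas below.\<close>

definition vilenkin_digit :: "(nat \<Rightarrow> nat) \<Rightarrow> nat \<Rightarrow> nat \<Rightarrow> nat" where
  "vilenkin_digit m n j = (n div vilenkin_M m j) mod m j"

lemma vilenkin_M_gt:
  assumes "\<forall>k. m k \<ge> 2"
  shows "n < vilenkin_M m n"
proof (induction n)
  case (Suc n)
  have "Suc n < 2 * vilenkin_M m n" using Suc by linarith
  also have "\<dots> \<le> m n * vilenkin_M m n" using assms by (intro mult_right_mono) auto
  finally show ?case by simp
qed simp

lemma vilenkin_M_expansion_mod:
  "(\<Sum>j<N. vilenkin_digit m n j * vilenkin_M m j) = n mod vilenkin_M m N"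
proof (induction N)
  case (Suc N)
  then show ?case
    using mod_mult2_eq[of n "vilenkin_M m N" "m N"]
    by (simp add: vilenkin_digit_def mult.commute)
qed simp

lemma vilenkin_digit_expansion:
  assumes m: "\<forall>k. m k \<ge> 2"
  shows "vilenkin_digit m n j < m j"
    and "finite {j. vilenkin_digit m n j \<noteq> 0}"
    and "n = (\<Sum>j | vilenkin_digit m n j \<noteq> 0. vilenkin_digit m n j * vilenkin_M m j)"
proof -
  have "0 < m j" using m by (metis less_le_trans pos2)
  then show "vilenkin_digit m n j < m j" by (simp add: vilenkin_digit_def)
  have sub: "{j. vilenkin_digit m n j \<noteq> 0} \<subseteq> {..<n}"
  proof
    fix j assume j: "j \<in> {j. vilenkin_digit m n j \<noteq> 0}"
    have "\<not> n \<le> j"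
    proof
      assume "n \<le> j"
      then have "n < vilenkin_M m j" using vilenkin_M_gt[OF m, of j] by linarith
      then show False using j by (simp add: vilenkin_digit_def)
    qed
    then show "j \<in> {..<n}" by simp
  qed
  then show "finite {j. vilenkin_digit m n j \<noteq> 0}" by (rule finite_subset) simp
  have "n = n mod vilenkin_M m n" using vilenkin_M_gt[OF m, of n] by simp
  also have "\<dots> = (\<Sum>j<n. vilenkin_digit m n j * vilenkin_M m j)"
    by (simp only: vilenkin_M_expansion_mod)
  also have "\<dots> = (\<Sum>j | vilenkin_digit m n j \<noteq> 0. vilenkin_digit m n j * vilenkin_M m j)"
    using sub by (intro sum.mono_neutral_right) auto
  finally show "n = (\<Sum>j | vilenkin_digit m n j \<noteq> 0. vilenkin_digit m n j * vilenkin_M m j)" .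
qed

definition rademacher :: "(nat \<Rightarrow> nat) \<Rightarrow> nat \<Rightarrow> (nat \<Rightarrow> int) \<Rightarrow> complex" where
  "rademacher m k x = exp (2 * of_real pi * \<i> * of_int (x k) / of_nat (m k))"

text \<open>Only the finitely many factors with nonzero exponent are multiplied.\<close>

definition vilenkin_psi :: "(nat \<Rightarrow> nat) \<Rightarrow> nat \<Rightarrow> (nat \<Rightarrow> int) \<Rightarrow> complex" where
  "vilenkin_psi m n x =
     (\<Prod>k | vilenkin_digit m n k \<noteq> 0. rademacher m k x ^ vilenkin_digit m n k)"

definition vilenkin_fourier_coeff ::
  "(nat \<Rightarrow> nat) \<Rightarrow> ((nat \<Rightarrow> int) \<Rightarrow> complex) \<Rightarrow> nat \<Rightarrow> complex" where
  "vilenkin_fourier_coeff m f k = (LINT x|vilenkin_measure m. f x * cnj (vilenkin_psi m k x))"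

definition cesaro_number :: "real \<Rightarrow> nat \<Rightarrow> real" where
  "cesaro_number \<beta> n = pochhammer (\<beta> + 1) n / fact n"

definition cesaro_mean ::
  "(nat \<Rightarrow> nat) \<Rightarrow> real \<Rightarrow> nat \<Rightarrow> ((nat \<Rightarrow> int) \<Rightarrow> complex) \<Rightarrow> (nat \<Rightarrow> int) \<Rightarrow> complex" where
  "cesaro_mean m \<beta> n f x =
     1 / of_real (cesaro_number \<beta> n) *
       (\<Sum>k\<le>n. of_real (cesaro_number \<beta> (n - k)) *
          vilenkin_fourier_coeff m f k * vilenkin_psi m k x)"

text \<open>
  Elements of the space are functions rather than classes modulo null sets; for
  \<open>p = \<infinity>\<close> the space consists of the continuous functions.  Values of a function
  outside the carrier of the group play no role.
\<close>

definition vilenkin_Lp ::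
  "(nat \<Rightarrow> nat) \<Rightarrow> ennreal \<Rightarrow> ((nat \<Rightarrow> int) \<Rightarrow> complex) set" where
  "vilenkin_Lp m p =
     (if p = \<infinity> then {f. continuous_map (vilenkin_topology m) euclidean f}
      else {f \<in> borel_measurable (vilenkin_measure m).
              integrable (vilenkin_measure m) (\<lambda>x. norm (f x) powr enn2real p)})"

text \<open>The value is a real number, hence the intended norm only for functions in the space above.\<close>

definition vilenkin_norm ::
  "(nat \<Rightarrow> nat) \<Rightarrow> ennreal \<Rightarrow> ((nat \<Rightarrow> int) \<Rightarrow> complex) \<Rightarrow> real" where
  "vilenkin_norm m p f =
     (if p = \<infinity> then (SUP x\<in>carrier (vilenkin_group m). norm (f x))
      else (LINT x|vilenkin_measure m. norm (f x) powr enn2real p) powr (1 / enn2real p))"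

text \<open>
  The modulus of continuity at \<open>1 / M\<^sub>n\<close>.  For \<open>f\<close> in the space above and \<open>p \<ge> 1\<close> the
  supremum is over a nonempty set of reals bounded by twice the norm of \<open>f\<close>.
\<close>

definition vilenkin_modulus ::
  "(nat \<Rightarrow> nat) \<Rightarrow> ennreal \<Rightarrow> nat \<Rightarrow> ((nat \<Rightarrow> int) \<Rightarrow> complex) \<Rightarrow> real" where
  "vilenkin_modulus m p n f =
     (SUP h\<in>vilenkin_I m n. vilenkin_norm m p (\<lambda>x. f (x \<otimes>\<^bsub>vilenkin_group m\<^esub> h) - f x))"

end

theory Submission
  imports Defs
begin

text \<open>
  Write \<open>A\<^sub>n\<close> for the Cesaro number of order \<open>- \<alpha>\<close>, which is comparable to \<open>(n + 1)\<close> to the power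
  \<open>- \<alpha>\<close>, and \<open>S\<^sub>j f\<close> for the partial sum of the Vilenkin-Fourier series of \<open>f\<close> over the frequencies below
  \<open>M\<^sub>j\<close>.  Three facts carry the proof.

  \<^item> \<open>S\<^sub>j f\<close> is the average of the translates of \<open>f\<close> by elements of \<open>I\<^sub>j\<close>, because the Dirichlet kernel of
    order \<open>M\<^sub>j\<close> is \<open>M\<^sub>j\<close> times the indicator of \<open>I\<^sub>j\<close>.  By Minkowski's integral inequality the
    remainder \<open>f - S\<^sub>j f\<close> has norm at most the modulus of continuity at \<open>1 / M\<^sub>j\<close>
    (\<open>N_partial_M_le\<close>).  The same inequality bounds every Fourier multiplier by the
    \<open>L\<^sup>1\<close> norm of its kernel (\<open>N_multiplier_le\<close>), for all \<open>p\<close> at once.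

  \<^item> The unnormalised kernel \<open>\<Sum>l\<le>n. A\<^sub>n\<^sub>-\<^sub>l \<psi>\<^sub>l\<close> is bounded in \<open>L\<^sup>1\<close> (\<open>L1_cesaro_kernel\<close>), so
    the Cesaro means as operators have norm at most a multiple of \<open>1 / A\<^sub>n\<close>, that is, of \<open>n\<close> to the
    power \<open>\<alpha>\<close>.  This is the rate in the hypothesis, and no logarithm can be spared.

  \<^item> On frequencies below \<open>L \<le> n / 2\<close> the Cesaro weights deviate from \<open>1\<close> so smoothly that the
    multiplier with weights \<open>A\<^sub>n\<^sub>-\<^sub>l / A\<^sub>n - 1\<close> has norm at most \<open>L / n\<close> times a small
    power of \<open>L\<close> (\<open>L1_cesaro_deviation\<close>).

  For \<open>M\<^sub>k \<le> n < M\<^sub>k\<^sub>+\<^sub>1\<close> put \<open>K = k - 1\<close>, so that \<open>M\<^sub>K \<le> n / 2\<close>.  The means of \<open>f - S\<^sub>K f\<close> are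
  at most \<open>M\<^sub>k\<close> to the power \<open>\<alpha>\<close> times the modulus at \<open>1 / M\<^sub>k\<^sub>-\<^sub>1\<close>, up to a constant, and tend to
  \<open>0\<close> by hypothesis.  The frequencies below \<open>M\<^sub>K\<close> are cut into the bands from \<open>M\<^sub>j\<close> to
  \<open>M\<^sub>j\<^sub>+\<^sub>1\<close>; on each band \<open>f\<close> may be replaced by \<open>f - S\<^sub>j f\<close>, and the resulting bounds sum to
  a negative power of \<open>n\<close>.
\<close>

section \<open>Vilenkin characters\<close>

locale vilenkin =
  fixes m :: "nat \<Rightarrow> nat"
  assumes m_ge_2: "\<forall>k. m k \<ge> 2"
begin

abbreviation M :: "nat \<Rightarrow> nat" where "M \<equiv> vilenkin_M m"
abbreviation digit :: "nat \<Rightarrow> nat \<Rightarrow> nat" where "digit \<equiv> vilenkin_digit m"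
abbreviation rad :: "nat \<Rightarrow> (nat \<Rightarrow> int) \<Rightarrow> complex" where "rad \<equiv> rademacher m"
abbreviation psi :: "nat \<Rightarrow> (nat \<Rightarrow> int) \<Rightarrow> complex" where "psi \<equiv> vilenkin_psi m"
abbreviation G :: "(nat \<Rightarrow> int) set" where "G \<equiv> carrier (vilenkin_group m)"
abbreviation mu :: "(nat \<Rightarrow> int) measure" where "mu \<equiv> vilenkin_measure m"
abbreviation add :: "(nat \<Rightarrow> int) \<Rightarrow> (nat \<Rightarrow> int) \<Rightarrow> nat \<Rightarrow> int" (infixl \<open>\<boxplus>\<close> 65)
  where "x \<boxplus> y \<equiv> x \<otimes>\<^bsub>vilenkin_group m\<^esub> y"

lemma m_pos [simp]: "0 < m k"
  using m_ge_2 by (metis less_le_trans pos2)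

lemma two_le_m: "2 \<le> m k"
  using m_ge_2 by blast

lemma M_pos [simp]: "0 < M k"
  by (induction k) auto

lemma M_Suc_ge: "2 * M k \<le> M (Suc k)"
  using two_le_m[of k] by simp

lemma M_ge_pow: "2 ^ k \<le> M k"
proof (induction k)
  case (Suc k)
  then show ?case using M_Suc_ge[of k] by (simp del: vilenkin_M.simps)
qed simp

lemma M_mono: "i \<le> j \<Longrightarrow> M i \<le> M j"
proof (rule lift_Suc_mono_le[of M])
  show "M k \<le> M (Suc k)" for k using M_Suc_ge[of k] by linarith
qed

lemma add_apply: "(x \<boxplus> y) k = (x k + y k) mod int (m k)"
  by (simp add: vilenkin_group_def)

lemma in_G_iff: "x \<in> G \<longleftrightarrow> (\<forall>k. 0 \<le> x k \<and> x k < int (m k))"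
proof -
  have "carrier (integer_mod_group (m k)) = {0..<int (m k)}" for k
    using m_pos[of k] by (simp add: carrier_integer_mod_group)
  then show ?thesis by (auto simp: vilenkin_group_def PiE_UNIV_domain)
qed

lemma add_in_G [simp]: "x \<boxplus> y \<in> G"
  by (simp add: in_G_iff add_apply)

lemma ex_M_interval:
  assumes "0 < n"
  shows "\<exists>k. M k \<le> n \<and> n < M (Suc k)"
proof -
  have ex: "n < M n" by (rule vilenkin_M_gt[OF m_ge_2])
  define j where "j = (LEAST j. n < M j)"
  have j: "n < M j" unfolding j_def by (rule LeastI, rule ex)
  have "j \<noteq> 0" using j assms by (intro notI) simp
  then obtain k where k: "j = Suc k" by (cases j) auto
  have "\<not> n < M k" using not_less_Least[of k "\<lambda>j. n < M j"] k j_def by auto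
  then show ?thesis using j k by (intro exI[of _ k]) simp
qed

text \<open>Removing the leading mixed radix digit more than halves a number.  The inductions on the order
  of a kernel run along this step, and the factor \<open>2\<close> makes their error terms geometric.\<close>

lemma leading_digit:
  assumes "0 < n"
  obtains k q r where "n = q * M k + r" "r < M k" "1 \<le> q" "q < m k" "2 * r < n"
proof -
  obtain k where k: "M k \<le> n" "n < M (Suc k)" using ex_M_interval[OF assms] by blast
  define q where "q = n div M k"
  define r where "r = n mod M k"
  have e: "n = q * M k + r" unfolding q_def r_def by (rule div_mult_mod_eq[symmetric])
  have r: "r < M k" by (simp add: r_def)
  have q1: "1 \<le> q" using k by (simp add: q_def Suc_le_eq div_greater_zero_iff)
  have "q < m k" unfolding q_def using k by (simp add: less_mult_imp_div_less)
  moreover have "2 * r < n"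
  proof -
    have "M k \<le> q * M k" using q1 by simp
    then show ?thesis using e r by linarith
  qed
  ultimately show ?thesis using that e r q1 by blast
qed

lemma digit_split:
  assumes "r < M k" "i < m k"
  shows "digit (i * M k + r) j = (if j < k then digit r j else if j = k then i else 0)"
proof -
  consider "j < k" | "j = k" | "k < j" by linarith
  then show ?thesis
  proof cases
    case 1
    have dv: "M (Suc j) dvd M k" using 1
    proof (induction k)
      case (Suc k)
      show ?case
      proof (cases "j = k")
        case False
        then have "M (Suc j) dvd M k" using Suc by simp
        then show ?thesis by simp
      qed simp
    qed simp
    then obtain c where c: "M k = M (Suc j) * c" by (elim dvdE)
    have "(i * M k + r) div M j = (r + (i * c * m j) * M j) div M j"
      by (simp add: c algebra_simps)
    also have "\<dots> = i * c * m j + r div M j" by simp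
    finally show ?thesis using 1 by (simp add: vilenkin_digit_def)
  next
    case 2
    then show ?thesis using assms by (simp add: vilenkin_digit_def)
  next
    case 3
    have "i * M k + r < (i + 1) * M k" using assms by simp
    also have "\<dots> \<le> m k * M k" using assms by (intro mult_right_mono) auto
    also have "\<dots> \<le> M j" using M_mono[of "Suc k" j] 3 by simp
    finally show ?thesis using 3 by (simp add: vilenkin_digit_def)
  qed
qed

lemma digit_zero: "n < M k \<Longrightarrow> k \<le> j \<Longrightarrow> digit n j = 0"
  using M_mono[of k j] by (simp add: vilenkin_digit_def)

lemma psi_eq_prod:
  assumes "n < M k"
  shows "psi n x = (\<Prod>j<k. rad j x ^ digit n j)"
  unfolding vilenkin_psi_def
proof (rule prod.mono_neutral_left)
  show "{j. digit n j \<noteq> 0} \<subseteq> {..<k}"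
    using digit_zero[OF assms] by (force simp: not_less[symmetric])
qed auto

lemma psi_0 [simp]: "psi 0 x = 1"
  by (simp add: vilenkin_psi_def vilenkin_digit_def)

lemma psi_split:
  assumes "r < M k" "i < m k"
  shows "psi (i * M k + r) x = rad k x ^ i * psi r x"
proof -
  have "i * M k + r < (i + 1) * M k" using assms by simp
  also have "\<dots> \<le> m k * M k" using assms by (intro mult_right_mono) auto
  finally have l: "i * M k + r < M (Suc k)" by simp
  show ?thesis
    using psi_eq_prod[OF l] psi_eq_prod[OF assms(1)]
    by (simp add: digit_split[OF assms])
qed

lemma norm_rad [simp]: "norm (rad k x) = 1"
proof -
  have "rad k x = exp (\<i> * of_real (2 * pi * x k / m k))"
    by (simp add: rademacher_def algebra_simps)
  then show ?thesis by (simp only: norm_exp_i_times)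
qed

lemma rad_cnj_rad [simp]: "rad k x * cnj (rad k x) = 1"
  using complex_norm_square[of "rad k x"] by simp

lemma norm_psi [simp]: "norm (psi n x) = 1"
  by (simp add: vilenkin_psi_def prod_norm[symmetric] norm_power)

lemma psi_cnj_psi [simp]: "psi n x * cnj (psi n x) = 1"
  using complex_norm_square[of "psi n x"] by simp

lemma exp_root_mod:
  assumes "0 < d"
  shows "exp (2 * of_real pi * \<i> * of_int (a mod int d) / of_nat d)
       = exp (2 * of_real pi * \<i> * of_int a / of_nat d)"
proof -
  define q where "q = a div int d"
  have a: "a = int d * q + a mod int d" by (simp add: q_def)
  have "2 * of_real pi * \<i> * complex_of_int a / of_nat d
      = 2 * of_real pi * \<i> * of_int (a mod int d) / of_nat d + 2 * of_real pi * \<i> * of_int q"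
    using assms by (subst a) (simp add: field_simps)
  moreover have "exp (2 * of_real pi * \<i> * of_int q) = 1"
    using exp_integer_2pi[of "of_int q"] by (simp add: algebra_simps)
  ultimately show ?thesis by (simp add: exp_add)
qed

lemma rad_add: "rad k (x \<boxplus> y) = rad k x * rad k y"
proof -
  have "rad k (x \<boxplus> y) = exp (2 * of_real pi * \<i> * of_int (x k + y k) / of_nat (m k))"
    unfolding rademacher_def add_apply by (rule exp_root_mod) simp
  then show ?thesis
    by (simp add: rademacher_def exp_add[symmetric] field_simps)
qed

lemma psi_add: "psi n (x \<boxplus> y) = psi n x * psi n y"
  by (simp add: vilenkin_psi_def rad_add power_mult_distrib prod.distrib)

lemma rad_power_m [simp]: "rad k x ^ m k = 1"
proof -
  have "rad k x ^ m k = exp (2 * of_real pi * \<i> * of_int (x k))"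
    using m_pos[of k] by (simp add: rademacher_def exp_of_nat_mult[symmetric])
  also have "\<dots> = 1" using exp_integer_2pi[of "of_int (x k)"] by (simp add: algebra_simps)
  finally show ?thesis .
qed

lemma rad_eq_1_iff:
  assumes "x \<in> G"
  shows "rad k x = 1 \<longleftrightarrow> x k = 0"
proof
  assume "rad k x = 1"
  then obtain n :: int where "2 * pi * x k / m k = of_int (2 * n) * pi"
    unfolding rademacher_def exp_eq_1 by (auto simp: Im_divide_of_nat)
  then have "real_of_int (x k) = real_of_int (n * int (m k))"
    using m_pos[of k] by (simp add: field_simps)
  then have "x k = n * int (m k)" by linarith
  moreover have "0 \<le> x k" "x k < int (m k)" using assms by (auto simp: in_G_iff)
  ultimately show "x k = 0"
    using mod_pos_pos_trivial[of "x k" "int (m k)"] by simp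
qed (simp add: rademacher_def)

text \<open>The digits of \<open>M\<^sub>k - 1 - t\<close> are the complements \<open>m\<^sub>j - 1 - t\<^sub>j\<close>, since the subtraction
  never borrows.  Hence reversing the order of a block of length \<open>M\<^sub>k\<close> only multiplies it by one
  character and conjugates it.\<close>

lemma psi_reflect:
  assumes "t < M k"
  shows "psi (M k - 1 - t) x = psi (M k - 1) x * cnj (psi t x)"
  using assms
proof (induction k arbitrary: t)
  case (Suc k)
  define i where "i = t div M k"
  define r where "r = t mod M k"
  have t: "t = i * M k + r" unfolding i_def r_def by (rule div_mult_mod_eq[symmetric])
  have r: "r < M k" by (simp add: r_def)
  have i: "i < m k" unfolding i_def using Suc.prems by (simp add: less_mult_imp_div_less)
  have e: "M (Suc k) - 1 - t = (m k - 1 - i) * M k + (M k - 1 - r)"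
  proof -
    obtain c where c: "m k = Suc (i + c)" using i less_iff_Suc_add by blast
    show ?thesis using r by (simp add: t c algebra_simps)
  qed
  have e0: "M (Suc k) - 1 = (m k - 1) * M k + (M k - 1)"
  proof -
    obtain c where c: "m k = Suc c" using m_pos[of k] gr0_implies_Suc by blast
    show ?thesis using M_pos[of k] by (simp add: c del: M_pos)
  qed
  have "psi (M (Suc k) - 1 - t) x = rad k x ^ (m k - 1 - i) * psi (M k - 1 - r) x"
    unfolding e by (rule psi_split) (use r i in auto)
  also have "\<dots> = rad k x ^ (m k - 1 - i) * (psi (M k - 1) x * cnj (psi r x))"
    by (simp only: Suc.IH[OF r])
  also have "rad k x ^ (m k - 1 - i) = rad k x ^ (m k - 1) * cnj (rad k x) ^ i"
  proof -
    have "m k - 1 = (m k - 1 - i) + i" using i by simp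
    then have "rad k x ^ (m k - 1) = rad k x ^ (m k - 1 - i) * rad k x ^ i"
      using power_add[of "rad k x" "m k - 1 - i" i] by simp
    then have "rad k x ^ (m k - 1) * cnj (rad k x) ^ i
        = rad k x ^ (m k - 1 - i) * (rad k x * cnj (rad k x)) ^ i"
      by (simp only: power_mult_distrib mult.assoc)
    then show ?thesis by simp
  qed
  also have "rad k x ^ (m k - 1) * cnj (rad k x) ^ i * (psi (M k - 1) x * cnj (psi r x))
      = (rad k x ^ (m k - 1) * psi (M k - 1) x) * cnj (rad k x ^ i * psi r x)"
    by simp
  also have "rad k x ^ (m k - 1) * psi (M k - 1) x = psi (M (Suc k) - 1) x"
    unfolding e0 by (rule psi_split[symmetric]) auto
  also have "rad k x ^ i * psi r x = psi t x"
    unfolding t by (rule psi_split[symmetric]) (use r i in auto)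
  finally show ?case .
qed simp

lemma digits_eqD:
  assumes "\<And>j. digit a j = digit b j"
  shows "a = b"
proof -
  define N where "N = max a b"
  have "N < M N" by (rule vilenkin_M_gt[OF m_ge_2])
  then have less: "a < M N" "b < M N" by (auto simp: N_def)
  have "a mod M N = b mod M N"
    unfolding vilenkin_M_expansion_mod[of m _ N, symmetric] by (simp only: assms)
  then show ?thesis using less by simp
qed

lemma ex_separating_point:
  assumes "a \<noteq> b"
  shows "\<exists>e\<in>G. psi a e \<noteq> psi b e"
proof -
  obtain j where j: "digit a j \<noteq> digit b j" using digits_eqD assms by blast
  \<comment> \<open>The \<open>j\<close>-th unit vector: only the \<open>j\<close>-th digit enters the value of a character there.\<close>
  define e :: "nat \<Rightarrow> int" where "e = (\<lambda>k. if k = j then 1 else 0)"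
  have eG: "e \<in> G" using two_le_m by (auto simp: in_G_iff e_def intro: less_le_trans[of _ 2])
  have psi_e: "psi n e = exp (2 * of_real pi * \<i> * of_int (int (digit n j)) / of_nat (m j))" for n
  proof -
    have *: "rad k e = 1" if "k \<noteq> j" for k using that by (simp add: e_def rademacher_def)
    have "n < M (max n (Suc j))" 
      using vilenkin_M_gt[OF m_ge_2, of "max n (Suc j)"] by linarith
    then have "psi n e = (\<Prod>k<max n (Suc j). rad k e ^ digit n k)" by (rule psi_eq_prod)
    also have "\<dots> = (\<Prod>k\<in>{j}. rad k e ^ digit n k)"
      by (rule prod.mono_neutral_right) (use * in auto)
    also have "\<dots> = exp (of_nat (digit n j) * (2 * of_real pi * \<i> / of_nat (m j)))"
      unfolding exp_of_nat_mult by (simp add: rademacher_def e_def)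
    finally show ?thesis by (simp add: algebra_simps)
  qed
  have "psi a e \<noteq> psi b e"
  proof
    assume "psi a e = psi b e"
    then obtain n :: int where "2 * of_real pi * \<i> * of_int (int (digit a j)) / of_nat (m j)
        = 2 * of_real pi * \<i> * of_int (int (digit b j)) / of_nat (m j) + (of_int (2 * n) * pi) * \<i>"
      unfolding psi_e exp_eq by blast
    then have "Im (2 * of_real pi * \<i> * of_int (int (digit a j)) / of_nat (m j))
        = Im (2 * of_real pi * \<i> * of_int (int (digit b j)) / of_nat (m j) + (of_int (2 * n) * pi) * \<i>)"
      by (rule arg_cong)
    then have "2 * pi * digit a j / m j = 2 * pi * digit b j / m j + 2 * n * pi"
      by (simp add: Im_divide_of_nat)
    then have "pi * (2 * digit a j / m j) = pi * (2 * digit b j / m j + 2 * n)"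
      by (simp add: algebra_simps)
    then have "2 * digit a j / m j = 2 * digit b j / m j + 2 * n"
      by (simp only: mult_cancel_left) simp
    then have "real (digit a j) = real (digit b j) + n * real (m j)"
      using m_pos[of j] by (simp add: field_simps)
    then have "real_of_int (int (digit a j)) = real_of_int (int (digit b j) + n * int (m j))" by simp
    then have "int (digit a j) = int (digit b j) + n * int (m j)" by linarith
    then have "int (digit a j) mod int (m j) = int (digit b j) mod int (m j)" by simp
    then show False using j by (simp add: vilenkin_digit_def flip: zmod_int)
  qed
  then show ?thesis using eG by blast
qed

end

section \<open>Haar measure and orthogonality\<close>

lemma borel_measurable_cnj [measurable (raw)]:
  assumes "f \<in> borel_measurable N"
  shows "(\<lambda>x. cnj (f x)) \<in> borel_measurable N"
  by (rule measurable_compose[OF assms borel_measurable_continuous_onI]) (rule continuous_on_cnj, rule continuous_on_id)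

context vilenkin
begin

abbreviation Z :: "nat \<Rightarrow> int set" where "Z k \<equiv> {0..<int (m k)}"

lemma mu_eq: "mu = PiM UNIV (\<lambda>k. uniform_count_measure (Z k))"
proof -
  have "carrier (integer_mod_group (m k)) = Z k" for k
    using m_pos[of k] by (simp add: carrier_integer_mod_group)
  then show ?thesis by (simp add: vilenkin_measure_def)
qed

lemma prob_space_factor: "prob_space (uniform_count_measure (Z k))"
  by (rule prob_space_uniform_count_measure) (use m_pos[of k] in auto)

lemma product_prob_space_factors: "product_prob_space (\<lambda>k. uniform_count_measure (Z k))"
  by (simp add: product_prob_space_def product_prob_space_axioms_def product_sigma_finite_def
      prob_space_factor prob_space_imp_sigma_finite)

lemma prob_space_mu: "prob_space mu"
  unfolding mu_eq by (rule prob_space_PiM) (rule prob_space_factor)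

sublocale mu: prob_space mu
  by (rule prob_space_mu)

sublocale mu_pair: pair_sigma_finite mu mu
  by unfold_locales

lemma space_mu: "space mu = G"
  by (auto simp: mu_eq space_PiM in_G_iff PiE_UNIV_domain space_uniform_count_measure Pi_iff)

lemma measurable_coord [measurable]: "(\<lambda>x. x k) \<in> mu \<rightarrow>\<^sub>M count_space UNIV"
proof -
  have "(\<lambda>x. x k) \<in> mu \<rightarrow>\<^sub>M uniform_count_measure (Z k)"
    unfolding mu_eq by (rule measurable_component_singleton) simp
  moreover have "(\<lambda>a. a) \<in> uniform_count_measure (Z k) \<rightarrow>\<^sub>M count_space UNIV"
    by (simp add: measurable_def sets_uniform_count_measure space_uniform_count_measure)
  ultimately show ?thesis by (rule measurable_compose)
qed

lemma measurable_into_mu: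
  assumes "\<And>k. (\<lambda>w. X w k) \<in> N \<rightarrow>\<^sub>M count_space UNIV" "\<And>w. w \<in> space N \<Longrightarrow> X w \<in> G"
  shows "X \<in> N \<rightarrow>\<^sub>M mu"
proof -
  have "(\<lambda>w k. X w k) \<in> N \<rightarrow>\<^sub>M PiM UNIV (\<lambda>k. uniform_count_measure (Z k))"
  proof (rule measurable_PiM_single')
    fix k
    have "(\<lambda>w. X w k) \<in> N \<rightarrow>\<^sub>M count_space (Z k)"
      unfolding measurable_count_space_eq2[OF finite_atLeastLessThan_int]
    proof (intro conjI ballI)
      show "(\<lambda>w. X w k) \<in> space N \<rightarrow> Z k" using assms(2) by (auto simp: in_G_iff)
      show "(\<lambda>w. X w k) -` {a} \<inter> space N \<in> sets N" for a
        by (rule measurable_sets[OF assms(1)]) simp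
    qed
    then show "(\<lambda>w. X w k) \<in> N \<rightarrow>\<^sub>M uniform_count_measure (Z k)"
      by (subst measurable_cong_sets[OF refl, of _ "count_space (Z k)"])
        (simp_all add: sets_uniform_count_measure)
  qed (use assms(2) in \<open>auto simp: space_uniform_count_measure in_G_iff\<close>)
  then show ?thesis by (simp add: mu_eq)
qed

lemma measurable_add [measurable]: "(\<lambda>p. fst p \<boxplus> snd p) \<in> mu \<Otimes>\<^sub>M mu \<rightarrow>\<^sub>M mu"
proof (rule measurable_into_mu)
  fix k
  have "(\<lambda>p. (fst p k, snd p k)) \<in> mu \<Otimes>\<^sub>M mu \<rightarrow>\<^sub>M count_space UNIV \<Otimes>\<^sub>M count_space UNIV"
    by (intro measurable_Pair measurable_compose[OF measurable_fst measurable_coord]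
        measurable_compose[OF measurable_snd measurable_coord])
  then have "(\<lambda>p. (fst p k, snd p k)) \<in> mu \<Otimes>\<^sub>M mu \<rightarrow>\<^sub>M count_space UNIV"
    by (simp add: pair_measure_countable)
  from measurable_compose[OF this, of "\<lambda>(a, b). (a + b) mod int (m k)" "count_space UNIV"]
  show "(\<lambda>p. (fst p \<boxplus> snd p) k) \<in> mu \<Otimes>\<^sub>M mu \<rightarrow>\<^sub>M count_space UNIV"
    by (simp add: add_apply)
qed simp

lemma measurable_shift [measurable]: "(\<lambda>x. x \<boxplus> h) \<in> mu \<rightarrow>\<^sub>M mu"
proof (rule measurable_into_mu)
  fix k
  from measurable_compose[OF measurable_coord, of "\<lambda>a. (a + h k) mod int (m k)" "count_space UNIV"]
  show "(\<lambda>x. (x \<boxplus> h) k) \<in> mu \<rightarrow>\<^sub>M count_space UNIV"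
    by (simp add: add_apply)
qed simp

lemma add_commute: "x \<boxplus> y = y \<boxplus> x"
  by (rule ext) (simp add: add_apply ac_simps)

lemma bij_betw_rotate: "bij_betw (\<lambda>a. (a + h) mod int (m k)) (Z k) (Z k)"
proof -
  have inj: "inj_on (\<lambda>a. (a + h) mod int (m k)) (Z k)"
  proof (rule inj_onI)
    fix a b assume ab: "a \<in> Z k" "b \<in> Z k" "(a + h) mod int (m k) = (b + h) mod int (m k)"
    from ab(3) have "(a + h - h) mod int (m k) = (b + h - h) mod int (m k)" by (rule mod_diff_cong) simp
    then show "a = b" using ab by simp
  qed
  moreover have "(\<lambda>a. (a + h) mod int (m k)) ` Z k = Z k"
    by (rule endo_inj_surj[OF _ _ inj]) auto
  ultimately show ?thesis by (simp add: bij_betw_def)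
qed

text \<open>The measure is translation invariant because each coordinate of a translation permutes the
  finite set of its values.\<close>

lemma distr_shift: "distr mu mu (\<lambda>x. x \<boxplus> h) = mu"
proof -
  interpret P: product_prob_space "\<lambda>k. uniform_count_measure (Z k)" UNIV
    by (rule product_prob_space_factors)
  let ?P = "\<lambda>k. uniform_count_measure (Z k)"
  have "distr mu mu (\<lambda>x. x \<boxplus> h) = PiM UNIV ?P"
  proof (rule P.PiM_eq)
    show "sets (distr mu mu (\<lambda>x. x \<boxplus> h)) = sets (PiM UNIV ?P)" by (simp add: mu_eq)
    fix J F assume J: "finite J" "J \<subseteq> (UNIV :: nat set)" and F: "\<And>j. j \<in> J \<Longrightarrow> F j \<in> sets (?P j)"
    define F' where "F' j = {a \<in> Z j. (a + h j) mod int (m j) \<in> F j}" for j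
    have eq: "(\<lambda>x. x \<boxplus> h) -` prod_emb UNIV ?P J (Pi\<^sub>E J F) \<inter> space mu = prod_emb UNIV ?P J (Pi\<^sub>E J F')"
    proof (rule Set.set_eqI)
      fix x
      show "x \<in> (\<lambda>x. x \<boxplus> h) -` prod_emb UNIV ?P J (Pi\<^sub>E J F) \<inter> space mu
          \<longleftrightarrow> x \<in> prod_emb UNIV ?P J (Pi\<^sub>E J F')"
        by (auto simp: prod_emb_iff space_mu in_G_iff add_apply space_uniform_count_measure F'_def)
    qed
    have Fs: "F j \<subseteq> Z j" if "j \<in> J" for j using F[OF that] by (simp add: sets_uniform_count_measure)
    have em: "emeasure (?P j) (F' j) = emeasure (?P j) (F j)" if "j \<in> J" for j
    proof -
      have "bij_betw (\<lambda>a. (a + h j) mod int (m j)) (F' j) (F j)"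
      proof (rule bij_betw_subset[OF bij_betw_rotate[of "h j" j]])
        show "F' j \<subseteq> Z j" by (auto simp: F'_def)
        have onto: "(\<lambda>a. (a + h j) mod int (m j)) ` Z j = Z j"
          using bij_betw_rotate by (simp add: bij_betw_def)
        show "(\<lambda>a. (a + h j) mod int (m j)) ` F' j = F j"
        proof
          show "F j \<subseteq> (\<lambda>a. (a + h j) mod int (m j)) ` F' j"
          proof
            fix b assume b: "b \<in> F j"
            then have "b \<in> (\<lambda>a. (a + h j) mod int (m j)) ` Z j"
              unfolding onto using Fs[OF that] by (rule subsetD[rotated])
            then obtain a where "a \<in> Z j" "b = (a + h j) mod int (m j)" by (elim imageE)
            then show "b \<in> (\<lambda>a. (a + h j) mod int (m j)) ` F' j"
              using b by (intro image_eqI[of _ _ a]) (simp_all add: F'_def)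
          qed
        qed (auto simp: F'_def)
      qed
      then have "card (F' j) = card (F j)" by (rule bij_betw_same_card)
      moreover have "F' j \<subseteq> Z j" by (auto simp: F'_def)
      ultimately show ?thesis using Fs[OF that]
        by (simp add: emeasure_uniform_count_measure)
    qed
    have emb: "prod_emb UNIV ?P J (Pi\<^sub>E J F) \<in> sets mu"
      unfolding mu_eq by (rule sets_PiM_I) (use J F in auto)
    have F's: "F' j \<in> sets (?P j)" for j by (auto simp: F'_def sets_uniform_count_measure)
    have "emeasure (distr mu mu (\<lambda>x. x \<boxplus> h)) (prod_emb UNIV ?P J (Pi\<^sub>E J F))
        = emeasure mu (prod_emb UNIV ?P J (Pi\<^sub>E J F'))"
      by (subst emeasure_distr) (use emb eq in auto)
    also have "\<dots> = (\<Prod>j\<in>J. emeasure (?P j) (F' j))"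
      unfolding mu_eq by (rule P.emeasure_PiM_emb) (use J F's in auto)
    finally show "emeasure (distr mu mu (\<lambda>x. x \<boxplus> h)) (prod_emb UNIV ?P J (Pi\<^sub>E J F))
        = (\<Prod>j\<in>J. emeasure (?P j) (F j))" using em by simp
  qed
  then show ?thesis by (simp add: mu_eq)
qed

lemma integral_shift:
  fixes f :: "(nat \<Rightarrow> int) \<Rightarrow> 'b::{banach, second_countable_topology}"
  assumes "f \<in> borel_measurable mu"
  shows "(LINT x|mu. f (x \<boxplus> h)) = (LINT x|mu. f x)"
  using integral_distr[OF measurable_shift assms, of h] by (simp add: distr_shift)

lemma integrable_shift:
  fixes f :: "(nat \<Rightarrow> int) \<Rightarrow> 'b::{banach, second_countable_topology}"
  assumes "integrable mu f"
  shows "integrable mu (\<lambda>x. f (x \<boxplus> h))"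
  by (rule integrable_distr[OF measurable_shift]) (simp add: distr_shift assms)

lemma measurable_rad [measurable]: "rad k \<in> borel_measurable mu"
  unfolding rademacher_def by measurable

lemma measurable_psi [measurable]: "psi n \<in> borel_measurable mu"
  unfolding vilenkin_psi_def by measurable

lemma integrable_bounded:
  fixes f :: "(nat \<Rightarrow> int) \<Rightarrow> 'b::{banach, second_countable_topology}"
  assumes "f \<in> borel_measurable mu" "\<And>x. x \<in> G \<Longrightarrow> norm (f x) \<le> C"
  shows "integrable mu f"
  by (rule mu.integrable_const_bound[of _ C]) (use assms in \<open>auto simp: space_mu\<close>)

lemma integrable_psi [simp]: "integrable mu (psi n)"
  by (rule integrable_bounded[of _ 1]) auto

text \<open>Translation by a point \<open>e\<close> that separates the two characters multiplies the integral by a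
  number different from \<open>1\<close>.\<close>

lemma psi_orthogonal:
  assumes "a \<noteq> b"
  shows "(LINT x|mu. psi a x * cnj (psi b x)) = 0"
proof -
  obtain e where e: "psi a e \<noteq> psi b e" using ex_separating_point[OF assms] by blast
  let ?I = "LINT x|mu. psi a x * cnj (psi b x)"
  have "?I = (LINT x|mu. psi a (x \<boxplus> e) * cnj (psi b (x \<boxplus> e)))"
    by (rule integral_shift[symmetric]) measurable
  also have "\<dots> = (LINT x|mu. (psi a e * cnj (psi b e)) * (psi a x * cnj (psi b x)))"
    by (simp add: psi_add ac_simps)
  also have "\<dots> = psi a e * cnj (psi b e) * ?I" by simp
  finally have "psi a e * cnj (psi b e) = 1 \<or> ?I = 0"
    by (metis mult_cancel_right1 mult.commute)
  moreover have "psi a e * cnj (psi b e) \<noteq> 1"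
  proof
    assume "psi a e * cnj (psi b e) = 1"
    then have "psi a e * cnj (psi b e) * psi b e = psi b e" by simp
    also have "psi a e * cnj (psi b e) * psi b e = psi a e * (psi b e * cnj (psi b e))"
      by (simp only: ac_simps)
    finally show False using e by simp
  qed
  ultimately show ?thesis by simp
qed

lemma psi_inner: "(LINT x|mu. psi a x * cnj (psi b x)) = (if a = b then 1 else 0)"
  using psi_orthogonal[of a b] mu.prob_space by simp

section \<open>Dirichlet kernels\<close>

definition L1 :: "((nat \<Rightarrow> int) \<Rightarrow> complex) \<Rightarrow> real" where
  "L1 g = (LINT u|mu. norm (g u))"

text \<open>The coefficients are real, so that conjugating the kernel conjugates only the characters and
  leaves the \<open>L\<^sup>1\<close> norm unchanged.\<close>

definition trig :: "(nat \<Rightarrow> real) \<Rightarrow> nat \<Rightarrow> (nat \<Rightarrow> int) \<Rightarrow> complex" where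
  "trig a L u = (\<Sum>l<L. of_real (a l) * psi l u)"

definition dirichlet :: "nat \<Rightarrow> (nat \<Rightarrow> int) \<Rightarrow> complex" where
  "dirichlet n u = (\<Sum>l<n. psi l u)"

lemma measurable_trig [measurable]: "trig a L \<in> borel_measurable mu"
  unfolding trig_def by measurable

lemma norm_trig_le: "norm (trig a L u) \<le> (\<Sum>l<L. \<bar>a l\<bar>)"
  unfolding trig_def by (rule order_trans[OF norm_sum]) (simp add: norm_mult)

lemma integrable_trig [simp]: "integrable mu (trig a L)"
  by (rule integrable_bounded[OF _ norm_trig_le]) measurable

lemma integrable_dirichlet [simp]: "integrable mu (dirichlet n)"
  unfolding dirichlet_def by simp

lemma L1_nonneg [simp]: "0 \<le> L1 g"
  by (simp add: L1_def)

lemma L1_cong: "(\<And>u. u \<in> G \<Longrightarrow> norm (f u) = norm (g u)) \<Longrightarrow> L1 f = L1 g"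
  unfolding L1_def by (rule Bochner_Integration.integral_cong) (auto simp: space_mu)

lemma L1_add:
  assumes "integrable mu f" "integrable mu g"
  shows "L1 (\<lambda>u. f u + g u) \<le> L1 f + L1 g"
proof -
  have "L1 (\<lambda>u. f u + g u) \<le> (LINT u|mu. norm (f u) + norm (g u))"
    unfolding L1_def by (rule integral_mono) (use assms in \<open>auto simp: norm_triangle_ineq\<close>)
  then show ?thesis using assms by (simp add: L1_def)
qed

lemma L1_sum:
  assumes "finite I" "\<And>i. i \<in> I \<Longrightarrow> integrable mu (f i)"
  shows "L1 (\<lambda>u. \<Sum>i\<in>I. f i u) \<le> (\<Sum>i\<in>I. L1 (f i))"
  using assms
proof (induction I rule: finite_induct)
  case (insert i I)
  have "L1 (\<lambda>u. \<Sum>j\<in>insert i I. f j u) = L1 (\<lambda>u. f i u + (\<Sum>j\<in>I. f j u))"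
    using insert by simp
  also have "\<dots> \<le> L1 (f i) + L1 (\<lambda>u. \<Sum>j\<in>I. f j u)"
    by (rule L1_add) (use insert in auto)
  finally show ?case using insert by simp
qed (simp add: L1_def)

lemma integrable_mult_unimodular:
  fixes f g :: "(nat \<Rightarrow> int) \<Rightarrow> complex"
  assumes "integrable mu g" "f \<in> borel_measurable mu" "\<And>u. u \<in> G \<Longrightarrow> norm (f u) = 1"
  shows "integrable mu (\<lambda>u. f u * g u)"
  by (rule Bochner_Integration.integrable_bound[OF assms(1)])
    (use assms in \<open>auto simp: norm_mult space_mu\<close>)

lemma L1_scale: "L1 (\<lambda>u. c * g u) = norm c * L1 g"
  by (simp add: L1_def norm_mult)

lemma sum_lessThan_add:
  fixes f :: "nat \<Rightarrow> 'b::comm_monoid_add"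
  shows "(\<Sum>l<a + b. f l) = (\<Sum>l<a. f l) + (\<Sum>r<b. f (a + r))"
  by (induction b) (simp_all add: add.assoc)

lemma sum_blocks:
  fixes f :: "nat \<Rightarrow> 'b::comm_monoid_add"
  shows "(\<Sum>l<q * k. f l) = (\<Sum>i<q. \<Sum>r<k. f (i * k + r))"
proof (induction q)
  case (Suc q)
  have "(\<Sum>l<Suc q * k. f l) = (\<Sum>l<q * k + k. f l)" by (simp add: add.commute)
  also have "\<dots> = (\<Sum>l<q * k. f l) + (\<Sum>r<k. f (q * k + r))"
    by (rule sum_lessThan_add)
  finally show ?case using Suc by simp
qed simp

lemma dirichlet_block:
  assumes "q \<le> m k"
  shows "dirichlet (q * M k) u = (\<Sum>i<q. rad k u ^ i) * dirichlet (M k) u"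
proof -
  have "dirichlet (q * M k) u = (\<Sum>i<q. \<Sum>r<M k. psi (i * M k + r) u)"
    unfolding dirichlet_def by (rule sum_blocks)
  also have "\<dots> = (\<Sum>i<q. \<Sum>r<M k. rad k u ^ i * psi r u)"
    by (intro sum.cong refl psi_split) (use assms in auto)
  finally show ?thesis by (simp add: dirichlet_def sum_product)
qed

lemma dirichlet_M:
  assumes "u \<in> G"
  shows "dirichlet (M k) u = (if \<forall>j<k. u j = 0 then of_nat (M k) else 0)"
proof (induction k)
  case (Suc k)
  have "(\<Sum>i<m k. rad k u ^ i) = (if u k = 0 then of_nat (m k) else 0)"
    using rad_eq_1_iff[OF assms, of k] geometric_sum[of "rad k u" "m k"] by auto
  then show ?case
    using dirichlet_block[of "m k" k u] Suc by (auto simp: less_Suc_eq)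
qed (simp add: dirichlet_def)

lemma integral_dirichlet: "0 < n \<Longrightarrow> (LINT u|mu. dirichlet n u) = 1"
proof -
  assume "0 < n"
  have "(LINT u|mu. dirichlet n u) = (\<Sum>l<n. LINT u|mu. psi l u * cnj (psi 0 u))"
    unfolding dirichlet_def by simp
  also have "\<dots> = (\<Sum>l<n. if l = 0 then 1 else 0)" by (simp only: psi_inner)
  finally show ?thesis using \<open>0 < n\<close> by (simp add: sum.delta)
qed

text \<open>The kernel \<open>D\<close> of order \<open>M\<^sub>k\<close> is nonnegative, so its norm is its mean value.\<close>

lemma L1_dirichlet_M: "L1 (dirichlet (M k)) = 1"
proof -
  have "L1 (dirichlet (M k)) = (LINT u|mu. Re (dirichlet (M k) u))"
    unfolding L1_def by (rule Bochner_Integration.integral_cong) (auto simp: dirichlet_M space_mu)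
  also have "\<dots> = Re (LINT u|mu. dirichlet (M k) u)" by simp
  finally show ?thesis by (simp add: integral_dirichlet)
qed

lemma trig_abel:
  "trig a L u = of_real (a L) * dirichlet L u
     + (\<Sum>l<L. of_real (a l - a (Suc l)) * dirichlet (Suc l) u)"
  by (induction L) (simp_all add: trig_def dirichlet_def algebra_simps)

lemma L1_trig_abel:
  "L1 (trig a L) \<le> \<bar>a L\<bar> * L1 (dirichlet L) + (\<Sum>l<L. \<bar>a l - a (Suc l)\<bar> * L1 (dirichlet (Suc l)))"
proof -
  have "L1 (trig a L) \<le> L1 (\<lambda>u. of_real (a L) * dirichlet L u)
      + L1 (\<lambda>u. \<Sum>l<L. of_real (a l - a (Suc l)) * dirichlet (Suc l) u)"
    unfolding trig_abel by (rule L1_add) auto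
  also have "L1 (\<lambda>u. \<Sum>l<L. of_real (a l - a (Suc l)) * dirichlet (Suc l) u)
      \<le> (\<Sum>l<L. L1 (\<lambda>u. of_real (a l - a (Suc l)) * dirichlet (Suc l) u))"
    by (rule L1_sum) auto
  finally show ?thesis by (simp only: L1_scale norm_of_real)
qed

end

locale bounded_vilenkin = vilenkin +
  fixes B :: nat
  assumes m_le_B: "m k \<le> B"
begin

lemma B_pos: "0 < B"
  using m_le_B[of 0] m_pos[of 0] by linarith

text \<open>Each digit of \<open>n\<close> contributes at most \<open>B\<close> to the norm, so the growth is at most logarithmic.
  An arbitrarily small power suffices, and is easier to combine with other powers of \<open>n\<close>.\<close>

lemma L1_dirichlet_le:
  assumes "0 < e"
  obtains C where "0 < C" "\<And>n. L1 (dirichlet n) \<le> C * real (n + 1) powr e"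
proof -
  define C where "C = real B / (2 powr e - 1)"
  have e1: "1 < 2 powr e" using assms by simp
  have C: "0 < C" using B_pos e1 by (simp add: C_def)
  have "L1 (dirichlet n) \<le> C * real (n + 1) powr e" for n
  proof (induction n rule: less_induct)
    case (less n)
    show ?case
    proof (cases "n = 0")
      case True
      then show ?thesis using C by (simp add: dirichlet_def L1_def)
    next
      case False
      then have "0 < n" by simp
      then obtain k q r where n: "n = q * M k + r" "r < M k" "1 \<le> q" "q < m k" "2 * r < n"
        by (rule leading_digit)
      \<comment> \<open>Split off the \<open>q\<close> full blocks of length \<open>M k\<close>; the rest is a shifted kernel of order \<open>r\<close>.\<close>
      have "dirichlet n u = (\<Sum>i<q. rad k u ^ i * dirichlet (M k) u) + psi (q * M k) u * dirichlet r u" for u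
      proof -
        have "psi (q * M k) u = rad k u ^ q" using psi_split[of 0 k q u] n by simp
        then have s: "psi (q * M k + s) u = psi (q * M k) u * psi s u" if "s < r" for s
          using psi_split[of s k q u] that n by simp
        have "dirichlet n u = dirichlet (q * M k) u + (\<Sum>s<r. psi (q * M k + s) u)"
          unfolding n(1) dirichlet_def by (rule sum_lessThan_add)
        also have "(\<Sum>s<r. psi (q * M k + s) u) = psi (q * M k) u * dirichlet r u"
          using s by (simp add: dirichlet_def sum_distrib_left)
        finally show ?thesis using n by (simp add: dirichlet_block sum_distrib_right)
      qed
      then have "L1 (dirichlet n)
          = L1 (\<lambda>u. (\<Sum>i<q. rad k u ^ i * dirichlet (M k) u) + psi (q * M k) u * dirichlet r u)"
        by (intro L1_cong) simp
      also have "\<dots> \<le> L1 (\<lambda>u. \<Sum>i<q. rad k u ^ i * dirichlet (M k) u) + L1 (\<lambda>u. psi (q * M k) u * dirichlet r u)"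
        by (rule L1_add)
          (auto intro!: Bochner_Integration.integrable_sum integrable_mult_unimodular simp: norm_power)
      also have "L1 (\<lambda>u. psi (q * M k) u * dirichlet r u) = L1 (dirichlet r)"
        by (rule L1_cong) (simp add: norm_mult)
      also have "L1 (\<lambda>u. \<Sum>i<q. rad k u ^ i * dirichlet (M k) u)
          \<le> (\<Sum>i<q. L1 (\<lambda>u. rad k u ^ i * dirichlet (M k) u))"
        by (rule L1_sum) (auto intro!: integrable_mult_unimodular simp: norm_power)
      also have "\<dots> = (\<Sum>i<q. L1 (dirichlet (M k)))"
        by (intro sum.cong refl L1_cong) (simp add: norm_mult norm_power)
      also have "\<dots> \<le> B" using n m_le_B[of k] by (simp add: L1_dirichlet_M)
      also have "real B + L1 (dirichlet r) \<le> C * (2 powr e - 1) * real (r + 1) powr e + C * real (r + 1) powr e"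
      proof (rule add_mono)
        have "1 \<le> real (r + 1) powr e" using assms by (simp add: ge_one_powr_ge_zero)
        moreover have "C * (2 powr e - 1) = real B" using e1 assms by (simp add: C_def)
        ultimately show "real B \<le> C * (2 powr e - 1) * real (r + 1) powr e"
          using mult_left_mono[of 1 "real (r + 1) powr e" "real B"] by simp
        show "L1 (dirichlet r) \<le> C * real (r + 1) powr e" using less n by simp
      qed
      also have "\<dots> = C * (2 * real (r + 1)) powr e"
        by (simp only: powr_mult) (simp add: algebra_simps)
      also have "\<dots> \<le> C * real (n + 1) powr e"
      proof -
        have "real (2 * (r + 1)) \<le> real (n + 1)" using n(5) by (intro of_nat_mono) simp
        then have "2 * real (r + 1) \<le> real (n + 1)" by simp
        then show ?thesis using C assms by (intro mult_left_mono powr_mono2) auto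
      qed
      finally show ?thesis by simp
    qed
  qed
  then show ?thesis using that C by blast
qed

end

section \<open>Cesaro numbers of negative order\<close>

lemma cesaro_number_0 [simp]: "cesaro_number b 0 = 1"
  by (simp add: cesaro_number_def)

lemma cesaro_number_Suc:
  "cesaro_number (- a) (Suc n) = cesaro_number (- a) n * (1 - a / real (Suc n))"
  by (simp add: cesaro_number_def pochhammer_Suc divide_simps)

lemma weighted_am_gm_1:
  fixes y t :: real
  assumes "0 < y" "0 \<le> t" "t \<le> 1"
  shows "y powr t \<le> t * y + (1 - t)"
  using Youngs_inequality_0[of t "1 - t" y 1] assms by simp

context
  fixes a :: real
  assumes a: "0 < a" "a < 1"
begin

lemma cesaro_number_pos: "0 < cesaro_number (- a) n"
proof (induction n)
  case (Suc n)
  have "a < real (Suc n)" using a by simp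
  then show ?case using Suc by (simp only: cesaro_number_Suc) simp
qed simp

text \<open>The Cesaro number is the product of \<open>1 - a / i\<close> over \<open>1 \<le> i \<le> n\<close>.  Both bounds compare it
  factor by factor with a telescoping product: of \<open>i / (i + 1)\<close> to the power \<open>a\<close> for the upper bound,
  and of \<open>(i - 1) / i\<close> to the power \<open>a\<close>, starting at \<open>i = 2\<close>, for the lower one.\<close>

lemma cesaro_number_upper: "cesaro_number (- a) n \<le> real (n + 1) powr (- a)"
proof (induction n)
  case (Suc n)
  define i where "i = real (Suc n)"
  have i: "0 < i" by (simp add: i_def)
  have "1 - a / i \<le> (1 + 1 / i) powr (- a)"
  proof -
    have "ln (1 + 1 / i) \<le> 1 / i" using i by (intro ln_add_one_self_le_self) auto
    then have "a * ln (1 + 1 / i) \<le> a * (1 / i)" using a by (intro mult_left_mono) auto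
    then have "1 - a / i \<le> 1 + - a * ln (1 + 1 / i)" by simp
    also have "\<dots> \<le> exp (- a * ln (1 + 1 / i))" by (rule exp_ge_add_one_self)
    finally show ?thesis using i add_pos_pos[of 1 "1 / i"] by (simp add: powr_def)
  qed
  then have "cesaro_number (- a) (Suc n) \<le> i powr (- a) * (1 + 1 / i) powr (- a)"
    unfolding cesaro_number_Suc i_def[symmetric]
    using Suc a i by (intro mult_mono) (auto simp: i_def add.commute)
  also have "\<dots> = (i * (1 + 1 / i)) powr (- a)" using i by (subst powr_mult) auto
  also have "i * (1 + 1 / i) = real (Suc n + 1)" using i by (simp add: distrib_left) (simp add: i_def)
  finally show ?case .
qed simp

lemma cesaro_number_lower: "(1 - a) * real (n + 1) powr (- a) \<le> cesaro_number (- a) n"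
proof (cases n)
  case 0
  then show ?thesis using a by simp
next
  case (Suc k)
  have "(1 - a) * real (k + 1) powr (- a) \<le> cesaro_number (- a) (Suc k)" for k
  proof (induction k)
    case 0
    then show ?case by (simp add: cesaro_number_Suc)
  next
    case (Suc k)
    define i where "i = real (Suc (Suc k))"
    have i: "1 < i" by (simp add: i_def)
    have "(1 - 1 / i) powr a \<le> a * (1 - 1 / i) + (1 - a)"
      by (rule weighted_am_gm_1) (use a i in auto)
    then have le: "(1 - 1 / i) powr a \<le> 1 - a / i" by (simp add: algebra_simps)
    have "real (Suc k + 1) powr (- a) = (i - 1) powr (- a) * (1 - 1 / i) powr a"
    proof -
      have "1 - 1 / i = (i - 1) / i" using i by (simp add: field_simps)
      then have "(1 - 1 / i) powr a = (i - 1) powr a / i powr a"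
        using i by (simp add: powr_divide)
      then show ?thesis using i by (simp add: powr_minus i_def field_simps)
    qed
    also have "i - 1 = real (k + 1)" by (simp add: i_def)
    finally have "(1 - a) * real (Suc k + 1) powr (- a)
        = ((1 - a) * real (k + 1) powr (- a)) * (1 - 1 / i) powr a" by simp
    also have "\<dots> \<le> cesaro_number (- a) (Suc k) * (1 - a / i)"
      using le Suc a cesaro_number_pos[of "Suc k"] by (intro mult_mono) auto
    finally show ?case by (simp only: cesaro_number_Suc[of a "Suc k"] i_def)
  qed
  from this[of k] have "(1 - a) * real n powr (- a) \<le> cesaro_number (- a) n" by (simp add: Suc)
  moreover have "real (n + 1) powr (- a) \<le> real n powr (- a)"
    using Suc a by (intro powr_mono2') auto
  ultimately show ?thesis using a by (smt (verit) mult_left_mono)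
qed

lemma cesaro_number_diff:
  "cesaro_number (- a) n - cesaro_number (- a) (Suc n) = a * cesaro_number (- a) n / real (n + 1)"
  by (simp add: cesaro_number_Suc field_simps)

lemma cesaro_number_abs_diff:
  "\<bar>cesaro_number (- a) n - cesaro_number (- a) (Suc n)\<bar> \<le> real (n + 1) powr (- 1 - a)"
proof -
  have "\<bar>cesaro_number (- a) n - cesaro_number (- a) (Suc n)\<bar> = a * cesaro_number (- a) n / real (n + 1)"
    unfolding cesaro_number_diff using a cesaro_number_pos[of n] by simp
  also have "\<dots> \<le> 1 * real (n + 1) powr (- a) / real (n + 1)"
    using a cesaro_number_upper[of n] cesaro_number_pos[of n]
    by (intro divide_right_mono mult_mono) auto
  also have "\<dots> = real (n + 1) powr (- 1 - a)"
    by (simp add: powr_diff powr_minus field_simps)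
  finally show ?thesis .
qed

end

section \<open>Norms of the Cesaro kernels\<close>

context bounded_vilenkin
begin

context
  fixes a :: real
  assumes a: "0 < a" "a < 1"
begin

text \<open>After an Abel transformation the terms decay like \<open>N + t + 1\<close> to the power \<open>- 1 - a\<close> times the
  norm of a Dirichlet kernel.  Of the exponent \<open>a\<close>, one half pays for that norm, one quarter keeps the
  series in \<open>t\<close> summable, and the last quarter remains as decay in \<open>N\<close>.\<close>

lemma L1_shifted_cesaro:
  obtains C where "0 < C"
    "\<And>N L. 1 \<le> N \<Longrightarrow> L1 (trig (\<lambda>t. cesaro_number (- a) (N + t)) L) \<le> C * real N powr (- a / 4)"
proof -
  obtain C where C: "0 < C" "\<And>n. L1 (dirichlet n) \<le> C * real (n + 1) powr (a / 2)"
    using L1_dirichlet_le[of "a / 2"] a by auto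
  define s where "s t = real (t + 1) powr (- 1 - a / 4)" for t
  have "summable (\<lambda>n. real n powr (- 1 - a / 4))"
    using a by (subst summable_real_powr_iff) auto
  then have sums: "summable s" unfolding s_def by (rule summable_ignore_initial_segment)
  define S where "S = (\<Sum>t. s t)"
  have S: "0 \<le> S" unfolding S_def by (rule suminf_nonneg[OF sums]) (simp add: s_def)
  have "L1 (trig (\<lambda>t. cesaro_number (- a) (N + t)) L) \<le> C * (1 + S) * real N powr (- a / 4)"
    if N: "1 \<le> N" for N L
  proof -
    define c where "c t = cesaro_number (- a) (N + t)" for t
    have first: "\<bar>c L\<bar> * L1 (dirichlet L) \<le> C * real N powr (- a / 4)"
    proof -
      have "\<bar>c L\<bar> * L1 (dirichlet L) \<le> real (N + L + 1) powr (- a) * (C * real (N + L + 1) powr (a / 2))"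
      proof (rule mult_mono)
        show "\<bar>c L\<bar> \<le> real (N + L + 1) powr (- a)"
          using cesaro_number_upper[OF a, of "N + L"] cesaro_number_pos[OF a, of "N + L"]
          by (simp add: c_def)
        have "real (L + 1) powr (a / 2) \<le> real (N + L + 1) powr (a / 2)"
          using a by (intro powr_mono2) auto
        then show "L1 (dirichlet L) \<le> C * real (N + L + 1) powr (a / 2)"
          using C by (meson mult_le_cancel_left_pos order_trans)
      qed auto
      also have "\<dots> = C * real (N + L + 1) powr (- a / 2)"
        by (simp add: powr_add[symmetric])
      also have "\<dots> \<le> C * real (N + L + 1) powr (- a / 4)"
        using C a by (intro mult_left_mono powr_mono) auto
      also have "\<dots> \<le> C * real N powr (- a / 4)"
        using C a N by (intro mult_left_mono powr_mono2') auto
      finally show ?thesis .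
    qed
    have each: "\<bar>c t - c (Suc t)\<bar> * L1 (dirichlet (Suc t)) \<le> C * real N powr (- a / 4) * s t" for t
    proof -
      have "\<bar>c t - c (Suc t)\<bar> * L1 (dirichlet (Suc t))
          \<le> real (N + t + 1) powr (- 1 - a) * (C * real (N + t + 1) powr (a / 2))"
      proof (rule mult_mono)
        show "\<bar>c t - c (Suc t)\<bar> \<le> real (N + t + 1) powr (- 1 - a)"
          using cesaro_number_abs_diff[OF a, of "N + t"] by (simp add: c_def)
        have "real (Suc t + 1) powr (a / 2) \<le> real (N + t + 1) powr (a / 2)"
          using a N by (intro powr_mono2) auto
        then show "L1 (dirichlet (Suc t)) \<le> C * real (N + t + 1) powr (a / 2)"
          using C by (meson mult_le_cancel_left_pos order_trans)
      qed auto
      also have "\<dots> = C * (real (N + t + 1) powr (- a / 4) * real (N + t + 1) powr (- 1 - a / 4))"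
        by (simp add: powr_add[symmetric])
      also have "\<dots> \<le> C * (real N powr (- a / 4) * s t)"
        unfolding s_def using C a N by (intro mult_left_mono mult_mono powr_mono2') auto
      finally show ?thesis by simp
    qed
    have "L1 (trig c L) \<le> \<bar>c L\<bar> * L1 (dirichlet L) + (\<Sum>l<L. \<bar>c l - c (Suc l)\<bar> * L1 (dirichlet (Suc l)))"
      by (rule L1_trig_abel)
    also have "\<dots> \<le> C * real N powr (- a / 4) + (\<Sum>l<L. C * real N powr (- a / 4) * s l)"
      by (intro add_mono first sum_mono each)
    also have "\<dots> = C * real N powr (- a / 4) * (1 + (\<Sum>l<L. s l))"
      by (simp add: distrib_left flip: sum_distrib_left)
    also have "\<dots> \<le> C * real N powr (- a / 4) * (1 + S)"
      using C unfolding S_def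
      by (intro mult_left_mono add_left_mono sum_le_suminf sums) (auto simp: s_def)
    finally show ?thesis by (simp add: c_def[abs_def] algebra_simps)
  qed
  then show ?thesis using that[of "C * (1 + S)"] C S by auto
qed

text \<open>An Abel transformation of the whole kernel would lose a logarithm, because the differences of
  its coefficients concentrate at \<open>l\<close> close to \<open>n\<close>, where the Dirichlet kernels are large.  Instead
  write \<open>n = q M\<^sub>k + r\<close> with leading digit \<open>q\<close>.  In each of the first \<open>q\<close> blocks of length \<open>M\<^sub>k\<close>,
  reversal turns the coefficients into Cesaro numbers with indices \<open>N, N + 1, \<dots>\<close> where \<open>N > r\<close>, now
  paired with Dirichlet kernels of small order, so the block costs only a constant times \<open>r + 1\<close> to the
  power \<open>- a / 4\<close>.  The remaining \<open>r + 1\<close> terms form the same kernel for \<open>r < n / 2\<close>.  The costs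
  grow geometrically as the successive remainders decrease to \<open>0\<close>, so they sum to a constant; the
  induction keeps track of this through a multiple of \<open>2 - (n + 1) powr (- a / 4)\<close>.\<close>

lemma L1_cesaro_kernel:
  obtains C where "0 < C" "\<And>n. L1 (trig (\<lambda>l. cesaro_number (- a) (n - l)) (Suc n)) \<le> C"
proof -
  obtain C where C: "0 < C"
    "\<And>N L. 1 \<le> N \<Longrightarrow> L1 (trig (\<lambda>t. cesaro_number (- a) (N + t)) L) \<le> C * real N powr (- a / 4)"
    by (rule L1_shifted_cesaro) blast
  \<comment> \<open>Large enough for \<open>n = 0\<close>, and such that the gain from doubling \<open>r + 1\<close> pays for \<open>B\<close> blocks.\<close>
  define K where "K = max 1 (B * C / (1 - 2 powr (- a / 4)))"
  have d: "2 powr (- a / 4) < 1" using a by (simp add: powr_less_one)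
  have K: "1 \<le> K" "B * C \<le> K * (1 - 2 powr (- a / 4))"
    using d by (auto simp: K_def pos_divide_le_eq[symmetric])
  have "L1 (trig (\<lambda>l. cesaro_number (- a) (n - l)) (Suc n)) \<le> K * (2 - real (n + 1) powr (- a / 4))" for n
  proof (induction n rule: less_induct)
    case (less n)
    show ?case
    proof (cases "n = 0")
      case True
      have "L1 (trig (\<lambda>l. cesaro_number (- a) (0 - l)) (Suc 0)) = 1"
        using mu.prob_space by (simp add: trig_def L1_def)
      then show ?thesis using K True by simp
    next
      case False
      then have "0 < n" by simp
      then obtain k q r where n: "n = q * M k + r" "r < M k" "1 \<le> q" "q < m k" "2 * r < n"
        by (rule leading_digit)
      define A where "A = cesaro_number (- a)"
      \<comment> \<open>The smallest value of \<open>n - l\<close> on the \<open>i\<close>-th block, attained at its last frequency.\<close>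
      define N where "N i = (q - 1 - i) * M k + r + 1" for i
      define blk where "blk i u = rad k u ^ i * (psi (M k - 1) u * cnj (trig (\<lambda>t. A (N i + t)) (M k) u))" for i u
      have block: "(\<Sum>s<M k. of_real (A (n - (i * M k + s))) * psi (i * M k + s) u) = blk i u"
        if i: "i < q" for i u
      proof -
        have "(\<Sum>s<M k. of_real (A (n - (i * M k + s))) * psi (i * M k + s) u)
            = (\<Sum>t<M k. of_real (A (n - (i * M k + (M k - Suc t)))) * psi (i * M k + (M k - Suc t)) u)"
          by (rule sum.nat_diff_reindex[symmetric])
        also have "\<dots> = (\<Sum>t<M k. of_real (A (N i + t)) * (rad k u ^ i * (psi (M k - 1) u * cnj (psi t u))))"
        proof (rule sum.cong[OF refl])
          fix t assume "t \<in> {..<M k}"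
          then have t: "t < M k" by simp
          obtain c where c: "q = Suc (i + c)" using i less_iff_Suc_add by blast
          have "n - (i * M k + (M k - Suc t)) = N i + t"
            using t by (simp add: n(1) N_def c algebra_simps)
          moreover have "psi (i * M k + (M k - Suc t)) u = rad k u ^ i * psi (M k - Suc t) u"
            by (rule psi_split) (use t i n in auto)
          moreover have "psi (M k - Suc t) u = psi (M k - 1) u * cnj (psi t u)"
            using psi_reflect[OF t, of u] by simp
          ultimately show "of_real (A (n - (i * M k + (M k - Suc t)))) * psi (i * M k + (M k - Suc t)) u
              = of_real (A (N i + t)) * (rad k u ^ i * (psi (M k - 1) u * cnj (psi t u)))" by simp
        qed
        also have "\<dots> = blk i u"
          by (simp add: blk_def trig_def sum_distrib_left ac_simps)
        finally show ?thesis .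
      qed
      have split: "trig (\<lambda>l. A (n - l)) (Suc n) u
          = (\<Sum>i<q. blk i u) + psi (q * M k) u * trig (\<lambda>l. A (r - l)) (Suc r) u" for u
      proof -
        have "psi (q * M k) u = rad k u ^ q" using psi_split[of 0 k q u] n by simp
        then have s: "psi (q * M k + s) u = psi (q * M k) u * psi s u" if "s < Suc r" for s
          using psi_split[of s k q u] that n by simp
        have "trig (\<lambda>l. A (n - l)) (Suc n) u = (\<Sum>l<q * M k + Suc r. of_real (A (n - l)) * psi l u)"
          by (simp add: trig_def n(1))
        also have "\<dots> = (\<Sum>l<q * M k. of_real (A (n - l)) * psi l u)
            + (\<Sum>s<Suc r. of_real (A (n - (q * M k + s))) * psi (q * M k + s) u)"
          by (rule sum_lessThan_add)
        also have "(\<Sum>l<q * M k. of_real (A (n - l)) * psi l u) = (\<Sum>i<q. blk i u)"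
          unfolding sum_blocks by (rule sum.cong) (use block in auto)
        also have "(\<Sum>s<Suc r. of_real (A (n - (q * M k + s))) * psi (q * M k + s) u)
            = psi (q * M k) u * trig (\<lambda>l. A (r - l)) (Suc r) u"
          unfolding trig_def sum_distrib_left
          by (rule sum.cong[OF refl]) (simp add: s n(1))
        finally show ?thesis .
      qed
      have blk_int: "integrable mu (blk i)" for i
        unfolding blk_def[abs_def]
        by (intro integrable_mult_unimodular) (auto simp: norm_power)
      have "L1 (trig (\<lambda>l. A (n - l)) (Suc n))
          = L1 (\<lambda>u. (\<Sum>i<q. blk i u) + psi (q * M k) u * trig (\<lambda>l. A (r - l)) (Suc r) u)"
        by (rule L1_cong) (simp only: split)
      also have "\<dots> \<le> L1 (\<lambda>u. \<Sum>i<q. blk i u) + L1 (\<lambda>u. psi (q * M k) u * trig (\<lambda>l. A (r - l)) (Suc r) u)"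
        by (rule L1_add) (auto intro!: blk_int integrable_mult_unimodular)
      also have "L1 (\<lambda>u. psi (q * M k) u * trig (\<lambda>l. A (r - l)) (Suc r) u) = L1 (trig (\<lambda>l. A (r - l)) (Suc r))"
        by (rule L1_cong) (simp add: norm_mult)
      also have "L1 (\<lambda>u. \<Sum>i<q. blk i u) \<le> (\<Sum>i<q. L1 (blk i))"
        by (rule L1_sum) (auto intro: blk_int)
      also have "\<dots> = (\<Sum>i<q. L1 (trig (\<lambda>t. A (N i + t)) (M k)))"
        by (intro sum.cong refl L1_cong) (simp add: blk_def norm_mult norm_power)
      also have "\<dots> \<le> (\<Sum>i<q. C * real (r + 1) powr (- a / 4))"
      proof (rule sum_mono)
        fix i
        have "L1 (trig (\<lambda>t. A (N i + t)) (M k)) \<le> C * real (N i) powr (- a / 4)"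
          unfolding A_def by (rule C(2)) (simp add: N_def)
        also have "\<dots> \<le> C * real (r + 1) powr (- a / 4)"
          using C a by (intro mult_left_mono powr_mono2') (auto simp: N_def)
        finally show "L1 (trig (\<lambda>t. A (N i + t)) (M k)) \<le> C * real (r + 1) powr (- a / 4)" .
      qed
      also have "\<dots> \<le> B * C * real (r + 1) powr (- a / 4)"
        using n m_le_B[of k] C by (simp add: mult_right_mono)
      also have "\<dots> \<le> K * (1 - 2 powr (- a / 4)) * real (r + 1) powr (- a / 4)"
        using K by (intro mult_right_mono) auto
      also have "L1 (trig (\<lambda>l. A (r - l)) (Suc r)) \<le> K * (2 - real (r + 1) powr (- a / 4))"
        unfolding A_def by (rule less) (use n in auto)
      also have "K * (1 - 2 powr (- a / 4)) * real (r + 1) powr (- a / 4) + K * (2 - real (r + 1) powr (- a / 4))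
          = K * (2 - (2 * real (r + 1)) powr (- a / 4))"
        by (simp only: powr_mult) (simp add: algebra_simps)
      also have "\<dots> \<le> K * (2 - real (n + 1) powr (- a / 4))"
      proof -
        have "real (2 * (r + 1)) \<le> real (n + 1)" using n(5) by (intro of_nat_mono) simp
        then have "2 * real (r + 1) \<le> real (n + 1)" by simp
        then show ?thesis using K a by (intro mult_left_mono diff_left_mono powr_mono2') auto
      qed
      finally show ?thesis by (simp add: A_def)
    qed
  qed
  then have "L1 (trig (\<lambda>l. cesaro_number (- a) (n - l)) (Suc n)) \<le> K * 2" for n
  proof (rule order_trans)
    show "K * (2 - real (n + 1) powr (- a / 4)) \<le> K * 2" using K by (intro mult_left_mono) auto
  qed
  then show ?thesis using that[of "K * 2"] K by auto
qed

text \<open>On frequencies below \<open>n / 2\<close> the weights vary by \<open>O (1 / n)\<close> from one to the next, and they start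
  at \<open>1\<close>, so an Abel transformation is efficient here.\<close>

lemma L1_cesaro_deviation:
  obtains C where "0 < C"
    "\<And>n L. \<lbrakk>0 < L; 2 * L \<le> n\<rbrakk> \<Longrightarrow>
      L1 (trig (\<lambda>l. cesaro_number (- a) (n - l) / cesaro_number (- a) n - 1) L)
        \<le> C * real L powr (1 + a / 2) / real (n + 1)"
proof -
  obtain C where C: "0 < C" "\<And>n. L1 (dirichlet n) \<le> C * real (n + 1) powr (a / 2)"
    using L1_dirichlet_le[of "a / 2"] a by auto
  define c where "c = 4 / (1 - a)"
  have c: "0 < c" using a by (simp add: c_def)
  have "L1 (trig (\<lambda>l. cesaro_number (- a) (n - l) / cesaro_number (- a) n - 1) L)
      \<le> (4 * c * C) * real L powr (1 + a / 2) / real (n + 1)" if L: "0 < L" "2 * L \<le> n" for n L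
  proof -
    define w where "w l = cesaro_number (- a) (n - l) / cesaro_number (- a) n - 1" for l
    have An: "0 < cesaro_number (- a) n" by (rule cesaro_number_pos[OF a])
    have inv: "1 / cesaro_number (- a) n \<le> real (n + 1) powr a / (1 - a)"
      using cesaro_number_lower[OF a, of n] An a
      by (simp add: powr_minus field_simps)
    have step: "\<bar>w l - w (Suc l)\<bar> \<le> c / real (n + 1)" if l: "l < L" for l
    proof -
      define j where "j = n - Suc l"
      have j: "n - l = Suc j" "n - Suc l = j" using l L by (auto simp: j_def)
      have j2: "real (n + 1) \<le> 2 * real (j + 1)" using l L by (simp add: j_def of_nat_diff)
      have "\<bar>w l - w (Suc l)\<bar>
          = \<bar>cesaro_number (- a) j - cesaro_number (- a) (Suc j)\<bar> * (1 / cesaro_number (- a) n)"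
        using An by (simp add: w_def j diff_divide_distrib[symmetric] abs_minus_commute)
      also have "\<dots> \<le> real (j + 1) powr (- 1 - a) * (real (n + 1) powr a / (1 - a))"
        by (intro mult_mono cesaro_number_abs_diff[OF a] inv) (use An in auto)
      also have "\<dots> \<le> (real (n + 1) / 2) powr (- 1 - a) * (real (n + 1) powr a / (1 - a))"
        using a j2 by (intro mult_right_mono powr_mono2') auto
      also have "\<dots> = 2 powr (1 + a) / ((1 - a) * real (n + 1))"
      proof -
        have "(real (n + 1) / 2) powr (- 1 - a) = 2 powr (1 + a) / (real (n + 1) * real (n + 1) powr a)"
          by (simp add: powr_divide powr_diff powr_minus powr_add field_simps)
        then show ?thesis by (simp add: mult.commute)
      qed
      also have "\<dots> \<le> 2 powr 2 / ((1 - a) * real (n + 1))"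
        using a by (intro divide_right_mono powr_mono) auto
      finally show ?thesis by (simp add: c_def)
    qed
    have wL: "\<bar>w L\<bar> \<le> c * real L / real (n + 1)"
    proof -
      have "w 0 - w L = (\<Sum>l<L. w l - w (Suc l))" by (rule sum_lessThan_telescope'[symmetric])
      then have "\<bar>w L\<bar> = \<bar>\<Sum>l<L. w l - w (Suc l)\<bar>" using An by (simp add: w_def)
      also have "\<dots> \<le> (\<Sum>l<L. c / real (n + 1))"
        by (rule order_trans[OF sum_abs sum_mono]) (use step in auto)
      finally show ?thesis by (simp add: mult.commute)
    qed
    have D: "L1 (dirichlet l) \<le> C * (2 * real L powr (a / 2))" if "l \<le> L" for l
    proof -
      have "L1 (dirichlet l) \<le> C * real (l + 1) powr (a / 2)" by (rule C(2))
      also have "\<dots> \<le> C * (2 * real L) powr (a / 2)"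
        using C a that L by (intro mult_left_mono powr_mono2) auto
      also have "(2 * real L) powr (a / 2) = 2 powr (a / 2) * real L powr (a / 2)"
        by (simp add: powr_mult)
      also have "\<dots> \<le> 2 powr 1 * real L powr (a / 2)"
        using a by (intro mult_right_mono powr_mono) auto
      finally show ?thesis using C by simp
    qed
    have "L1 (trig w L) \<le> \<bar>w L\<bar> * L1 (dirichlet L) + (\<Sum>l<L. \<bar>w l - w (Suc l)\<bar> * L1 (dirichlet (Suc l)))"
      by (rule L1_trig_abel)
    also have "\<dots> \<le> c * real L / real (n + 1) * (C * (2 * real L powr (a / 2)))
        + (\<Sum>l<L. c / real (n + 1) * (C * (2 * real L powr (a / 2))))"
      by (intro add_mono sum_mono mult_mono wL step D) (use c in auto)
    also have "\<dots> = (4 * c * C) * real L powr (1 + a / 2) / real (n + 1)"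
    proof -
      have "real L powr (1 + a / 2) = real L * real L powr (a / 2)" using L by (simp add: powr_add)
      then show ?thesis by simp
    qed
    finally show ?thesis by (simp add: w_def[abs_def])
  qed
  then show ?thesis using that[of "4 * c * C"] c C by auto
qed

end

end

section \<open>Minkowski's integral inequality\<close>

text \<open>Convexity of the \<open>p\<close>-th power in the form that can be integrated directly.  The point \<open>y = 0\<close> is
  included because norms of functions may vanish.\<close>

lemma powr_tangent:
  fixes p y s :: real
  assumes "1 \<le> p" "0 \<le> y" "0 < s"
  shows "s powr p + p * s powr (p - 1) * (y - s) \<le> y powr p"
proof -
  have sp: "s powr p = s * s powr (p - 1)" using assms by (simp add: powr_mult_base)
  show ?thesis
  proof (cases "y = 0")
    case True
    then show ?thesis using assms by (simp add: sp algebra_simps mult_right_mono)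
  next
    case False
    define z where "z = (y / s) powr p"
    have z: "0 < z" using False assms by (simp add: z_def)
    have "z powr (1 / p) \<le> 1 / p * z + (1 - 1 / p)"
      by (rule weighted_am_gm_1) (use assms z in auto)
    moreover have "z powr (1 / p) = y / s" using assms by (simp add: z_def powr_powr)
    ultimately have "p * (y / s) \<le> p * (1 / p * z + (1 - 1 / p))"
      using assms by (intro mult_left_mono) auto
    moreover have "p * (1 / p * z + (1 - 1 / p)) = z + (p - 1)"
      using assms by (simp add: distrib_left right_diff_distrib)
    ultimately have "p * (y / s) \<le> z + (p - 1)" by linarith
    then have "s powr p * (p * (y / s)) \<le> s powr p * (z + (p - 1))" by (rule mult_left_mono) simp
    moreover have "s powr p * z = y powr p" using assms False by (simp add: z_def powr_divide)
    moreover have "s powr p * (p * (y / s)) = p * s powr (p - 1) * y" using assms by (simp add: sp)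
    moreover have "s powr p * (z + (p - 1)) = s powr p * z + p * s powr (p - 1) * s - s powr p"
      by (simp add: sp algebra_simps)
    moreover have "p * s powr (p - 1) * (y - s) = p * s powr (p - 1) * y - p * s powr (p - 1) * s"
      by (rule right_diff_distrib)
    ultimately show ?thesis by linarith
  qed
qed

lemma powr_le_1_plus:
  fixes p y :: real
  assumes "1 \<le> p" "0 \<le> y"
  shows "y \<le> 1 + y powr p"
proof (cases "y \<le> 1")
  case False
  then have "y powr 1 \<le> y powr p" using assms by (intro powr_mono) auto
  then show ?thesis using False by simp
qed (simp add: add_increasing2)

lemma powr_convex:
  fixes p y z t :: real
  assumes p: "1 \<le> p" and y: "0 \<le> y" and z: "0 \<le> z" and t: "0 \<le> t" "t \<le> 1"
  shows "(t * y + (1 - t) * z) powr p \<le> t * y powr p + (1 - t) * z powr p"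
proof (cases "t * y + (1 - t) * z = 0")
  case False
  define s where "s = t * y + (1 - t) * z"
  have "0 \<le> s" using assms by (auto simp: s_def intro!: add_nonneg_nonneg mult_nonneg_nonneg)
  then have s: "0 < s" using False by (simp add: s_def)
  have "t * (s powr p + p * s powr (p - 1) * (y - s)) + (1 - t) * (s powr p + p * s powr (p - 1) * (z - s))
      \<le> t * y powr p + (1 - t) * z powr p"
    using assms s by (intro add_mono mult_left_mono powr_tangent) auto
  moreover have "t * (s powr p + p * s powr (p - 1) * (y - s)) + (1 - t) * (s powr p + p * s powr (p - 1) * (z - s))
      = s powr p + p * s powr (p - 1) * ((t * y + (1 - t) * z) - s)"
    by (simp add: algebra_simps)
  ultimately show ?thesis by (simp add: s_def)
qed (use assms in \<open>auto intro!: add_nonneg_nonneg mult_nonneg_nonneg\<close>)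

text \<open>Jensen's inequality with a weight: integrate the tangent of the \<open>p\<close>-th power at the weighted
  mean of \<open>u\<close>.\<close>

lemma weighted_jensen_powr:
  fixes u g :: "'a \<Rightarrow> real" and p :: real
  assumes p: "1 \<le> p"
    and [measurable]: "u \<in> borel_measurable N"
    and g: "integrable N g" "\<And>x. 0 \<le> g x"
    and u: "\<And>x. 0 \<le> u x"
    and up: "integrable N (\<lambda>x. u x powr p * g x)"
  shows "(LINT x|N. u x * g x) powr p \<le> (LINT x|N. g x) powr (p - 1) * (LINT x|N. u x powr p * g x)"
proof -
  have [measurable]: "g \<in> borel_measurable N" using g by simp
  have ug: "integrable N (\<lambda>x. u x * g x)"
  proof (rule Bochner_Integration.integrable_bound)
    show "integrable N (\<lambda>x. g x + u x powr p * g x)" using g up by simp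
    show "AE x in N. norm (u x * g x) \<le> norm (g x + u x powr p * g x)"
    proof (rule AE_I2)
      fix x
      have "u x * g x \<le> (1 + u x powr p) * g x"
        using powr_le_1_plus[OF p u] g by (intro mult_right_mono) auto
      then show "norm (u x * g x) \<le> norm (g x + u x powr p * g x)"
        using g u by (simp add: algebra_simps)
    qed
  qed simp
  define c where "c = (LINT x|N. g x)"
  define s where "s = (LINT x|N. u x * g x) / c"
  have c0: "0 \<le> c" unfolding c_def using g by simp
  show ?thesis
  proof (cases "c = 0")
    case True
    then have "AE x in N. g x = 0"
      unfolding c_def using g by (subst (asm) integral_nonneg_eq_0_iff_AE) auto
    then have "(LINT x|N. u x * g x) = (LINT x|N. 0)" by (intro integral_cong_AE) auto
    then show ?thesis using p by (simp add: c_def[symmetric] True)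
  next
    case False
    then have c: "0 < c" using c0 by simp
    have s0: "0 \<le> s" unfolding s_def using c u g by simp
    have sc: "(LINT x|N. u x * g x) = s * c" using c by (simp add: s_def)
    have rhs0: "0 \<le> (LINT x|N. u x powr p * g x)" using u g by simp
    have "s powr p * c \<le> (LINT x|N. u x powr p * g x)"
    proof (cases "s = 0")
      case False
      then have s: "0 < s" using s0 by simp
      define k where "k = p * s powr (p - 1)"
      have "(LINT x|N. (s powr p - k * s) * g x + k * (u x * g x)) \<le> (LINT x|N. u x powr p * g x)"
      proof (rule integral_mono)
        fix x
        have "(s powr p + k * (u x - s)) * g x \<le> u x powr p * g x"
          unfolding k_def using g by (intro mult_right_mono powr_tangent p u s)
        then show "(s powr p - k * s) * g x + k * (u x * g x) \<le> u x powr p * g x"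
          by (simp add: algebra_simps)
      qed (use g ug up in auto)
      also have "(LINT x|N. (s powr p - k * s) * g x + k * (u x * g x)) = (s powr p - k * s) * c + k * (s * c)"
        using g ug by (simp add: sc c_def)
      finally show ?thesis by (simp add: algebra_simps)
    qed (use rhs0 p in simp)
    then have "c powr (p - 1) * (s powr p * c) \<le> c powr (p - 1) * (LINT x|N. u x powr p * g x)"
      by (rule mult_left_mono) simp
    moreover have "c powr (p - 1) * (s powr p * c) = (s * c) powr p"
    proof -
      have "c * c powr (p - 1) = c powr p" using c by (simp add: powr_mult_base)
      then show ?thesis using c s0 by (simp add: powr_mult) (simp add: ac_simps)
    qed
    ultimately show ?thesis by (simp add: sc c_def)
  qed
qed

text \<open>Apply the weighted Jensen inequality for each \<open>x\<close> with weight \<open>|g|\<close>, integrate over \<open>x\<close> and exchange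
  the integrals.  The bound on \<open>F u\<close> is required only where \<open>g u \<noteq> 0\<close>: for a kernel \<open>g\<close> supported on a
  subgroup, only translates by that subgroup are then compared.\<close>

lemma (in pair_sigma_finite) minkowski_integral_powr:
  fixes F :: "'a \<Rightarrow> 'b \<Rightarrow> complex" and g :: "'a \<Rightarrow> complex" and p R :: real
  assumes p: "1 \<le> p" and R: "0 \<le> R"
    and F: "case_prod F \<in> borel_measurable (M1 \<Otimes>\<^sub>M M2)"
    and g: "integrable M1 g"
    and FR: "\<And>u. u \<in> space M1 \<Longrightarrow> g u \<noteq> 0 \<Longrightarrow>
      integrable M2 (\<lambda>x. norm (F u x) powr p) \<and> (LINT x|M2. norm (F u x) powr p) \<le> R powr p"
  shows "(LINT x|M2. norm (LINT u|M1. F u x * g u) powr p) \<le> ((LINT u|M1. norm (g u)) * R) powr p"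
proof -
  have [measurable]: "g \<in> borel_measurable M1" using g by simp
  note F[measurable]
  define W where "W u x = norm (F u x) powr p * norm (g u)" for u x
  have Wm [measurable]: "case_prod W \<in> borel_measurable (M1 \<Otimes>\<^sub>M M2)"
    unfolding W_def[abs_def] by measurable
  have W0: "0 \<le> W u x" for u x by (simp add: W_def)
  have inner: "integrable M2 (W u)" "(LINT x|M2. W u x) \<le> R powr p * norm (g u)" if "u \<in> space M1" for u
  proof -
    have "integrable M2 (W u) \<and> (LINT x|M2. W u x) \<le> R powr p * norm (g u)"
    proof (cases "g u = 0")
      case False
      then show ?thesis using FR[OF that] by (auto simp: W_def[abs_def] intro: mult_right_mono)
    qed (simp add: W_def[abs_def])
    then show "integrable M2 (W u)" "(LINT x|M2. W u x) \<le> R powr p * norm (g u)" by auto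
  qed
  have outer: "integrable M1 (\<lambda>u. LINT x|M2. W u x)"
  proof (rule Bochner_Integration.integrable_bound)
    show "integrable M1 (\<lambda>u. R powr p * norm (g u))" using g by simp
    show "AE u in M1. norm (LINT x|M2. W u x) \<le> norm (R powr p * norm (g u))"
      using inner W0 by (auto intro!: AE_I2)
  qed measurable
  have W: "integrable (M1 \<Otimes>\<^sub>M M2) (case_prod W)"
    by (rule Fubini_integrable) (use outer inner W0 in auto)
  define c where "c = (LINT u|M1. norm (g u))"
  have c0: "0 \<le> c" by (simp add: c_def)
  have "(LINT x|M2. norm (LINT u|M1. F u x * g u) powr p)
      \<le> (LINT x|M2. c powr (p - 1) * (LINT u|M1. W u x))"
  proof (rule integral_mono_AE')
    show "integrable M2 (\<lambda>x. c powr (p - 1) * (LINT u|M1. W u x))"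
      using integrable_snd[OF W] by simp
    show "AE x in M2. 0 \<le> c powr (p - 1) * (LINT u|M1. W u x)"
      using W0 by simp
    show "AE x in M2. norm (LINT u|M1. F u x * g u) powr p \<le> c powr (p - 1) * (LINT u|M1. W u x)"
      using AE_integrable_snd[OF W] AE_space
    proof eventually_elim
      case (elim x)
      have [measurable]: "(\<lambda>u. F u x) \<in> borel_measurable M1"
        using measurable_compose[OF measurable_Pair2'[OF elim(2)] F] by simp
      have "norm (LINT u|M1. F u x * g u) powr p \<le> (LINT u|M1. norm (F u x) * norm (g u)) powr p"
        using integral_norm_bound[of M1 "\<lambda>u. F u x * g u"] p
        by (intro powr_mono2) (auto simp: norm_mult)
      also have "\<dots> \<le> c powr (p - 1) * (LINT u|M1. W u x)"
        unfolding c_def W_def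
        by (rule weighted_jensen_powr) (use p g elim in \<open>auto simp: W_def\<close>)
      finally show ?case .
    qed
  qed
  also have "\<dots> = c powr (p - 1) * (LINT u|M1. LINT x|M2. W u x)"
    using Fubini_integral[OF W] by simp
  also have "(LINT u|M1. LINT x|M2. W u x) \<le> (LINT u|M1. R powr p * norm (g u))"
    by (rule integral_mono) (use outer inner g in auto)
  also have "c powr (p - 1) * (LINT u|M1. R powr p * norm (g u)) = (c * R) powr p"
  proof -
    have "c * c powr (p - 1) = c powr p"
      using c0 p by (cases "c = 0") (simp_all add: powr_mult_base)
    then show ?thesis using c0 R by (simp add: powr_mult c_def[symmetric]) (simp add: ac_simps)
  qed
  finally show ?thesis by (simp add: c_def mult_left_mono)
qed

section \<open>Lebesgue norms on the Vilenkin group\<close>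

text \<open>With this instance the Borel sets of the product topology on integer sequences are the sets of the
  product sigma-algebra, which makes continuous functions on the group measurable.\<close>

instance int :: second_countable_topology
proof
  show "\<exists>B::int set set. countable B \<and> open = generate_topology B"
    by (intro exI[of _ "range lessThan \<union> range greaterThan"])
      (auto simp: open_int_def)
qed

context vilenkin
begin

lemma G_nonempty: "G \<noteq> {}"
proof -
  have "(\<lambda>k. 0) \<in> G" by (simp add: in_G_iff)
  then show ?thesis by blast
qed

text \<open>For \<open>p = \<infinity>\<close> the estimates hold for all bounded measurable functions.  This space contains the
  continuous functions and is more easily seen to be closed under the operations that follow.\<close>

definition Leb :: "ennreal \<Rightarrow> ((nat \<Rightarrow> int) \<Rightarrow> complex) set" where
  "Leb p = (if p = \<infinity> then {f \<in> borel_measurable mu. \<exists>C. \<forall>x\<in>G. norm (f x) \<le> C} else vilenkin_Lp m p)"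

abbreviation N :: "ennreal \<Rightarrow> ((nat \<Rightarrow> int) \<Rightarrow> complex) \<Rightarrow> real" where "N \<equiv> vilenkin_norm m"

lemma vilenkin_topology_eq: "vilenkin_topology m = top_of_set G"
proof -
  have "discrete_topology (Z k) = top_of_set (Z k)" for k
  proof -
    have "discrete_topology UNIV = (euclidean :: int topology)"
      by (simp add: topology_eq discrete_topology_class.open_discrete flip: open_openin)
    then show ?thesis by (metis inf_top_left subtopology_discrete_topology)
  qed
  moreover have "carrier (integer_mod_group (m k)) = Z k" for k
    using m_pos[of k] by (simp add: carrier_integer_mod_group)
  ultimately have "vilenkin_topology m = product_topology (\<lambda>k. top_of_set (Z k)) UNIV"
    by (simp add: vilenkin_topology_def)
  also have "\<dots> = top_of_set (\<Pi>\<^sub>E k\<in>UNIV. Z k)"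
    by (simp add: euclidean_product_topology flip: subtopology_product_topology)
  also have "(\<Pi>\<^sub>E k\<in>UNIV. Z k) = G" by (auto simp: in_G_iff PiE_iff)
  finally show ?thesis .
qed

lemma Leb_of_Lp:
  assumes "f \<in> vilenkin_Lp m p"
  shows "f \<in> Leb p"
proof (cases "p = \<infinity>")
  case True
  have cont: "continuous_map (vilenkin_topology m) euclidean f"
    using assms True by (simp add: vilenkin_Lp_def)
  have "continuous_on G f" using cont by (simp add: vilenkin_topology_eq)
  then have f: "f \<in> borel_measurable (restrict_space borel G)"
    by (rule borel_measurable_continuous_on_restrict)
  have "(\<lambda>x. x) \<in> mu \<rightarrow>\<^sub>M restrict_space borel G"
  proof (rule measurable_restrict_space2)
    have "(\<lambda>x k. x k) \<in> mu \<rightarrow>\<^sub>M PiM UNIV (\<lambda>k::nat. borel :: int measure)"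
    proof (rule measurable_PiM_single')
      fix k :: nat
      show "(\<lambda>x. x k) \<in> mu \<rightarrow>\<^sub>M (borel :: int measure)"
        by (rule measurable_compose[OF measurable_coord]) simp
    qed auto
    moreover have "mu \<rightarrow>\<^sub>M PiM UNIV (\<lambda>k::nat. borel :: int measure) = mu \<rightarrow>\<^sub>M borel"
      by (rule measurable_cong_sets[OF refl sets_PiM_equal_borel])
    ultimately show "(\<lambda>x. x) \<in> mu \<rightarrow>\<^sub>M borel" by simp
  qed (simp add: space_mu)
  from measurable_compose[OF this f] have meas: "f \<in> borel_measurable mu" .
  have "compact_space (vilenkin_topology m)"
    unfolding vilenkin_topology_def compact_space_product_topology
    using m_pos by (auto simp: compact_space_discrete_topology carrier_integer_mod_group)
  then have "compactin euclidean (f ` G)"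
    using image_compactin[OF _ cont, of G] by (simp add: compact_space_def vilenkin_topology_eq)
  then have "bounded (f ` G)" by (simp add: compact_imp_bounded)
  then show ?thesis using meas True by (auto simp: Leb_def bounded_iff)
qed (use assms in \<open>simp add: Leb_def\<close>)

lemma N_cong:
  assumes "\<And>x. x \<in> G \<Longrightarrow> norm (f x) = norm (g x)"
  shows "N p f = N p g"
proof -
  have "(LINT x|mu. norm (f x) powr q) = (LINT x|mu. norm (g x) powr q)" for q
    by (rule Bochner_Integration.integral_cong) (use assms in \<open>auto simp: space_mu\<close>)
  moreover have "(SUP x\<in>G. norm (f x)) = (SUP x\<in>G. norm (g x))"
    by (rule SUP_cong) (use assms in auto)
  ultimately show ?thesis by (simp add: vilenkin_norm_def)
qed

context
  fixes p :: ennreal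
  assumes p1: "1 \<le> p"
begin

lemma enn2real_ge_1: "p \<noteq> \<infinity> \<Longrightarrow> 1 \<le> enn2real p"
  using enn2real_mono[OF p1] by (simp add: less_top)

lemma Leb_measurable: "f \<in> Leb p \<Longrightarrow> f \<in> borel_measurable mu"
  by (auto simp: Leb_def vilenkin_Lp_def split: if_splits)

lemma Leb_integrable:
  assumes "f \<in> Leb p"
  shows "integrable mu f"
proof (cases "p = \<infinity>")
  case True
  then show ?thesis using assms by (auto simp: Leb_def intro: integrable_bounded)
next
  case False
  show ?thesis
  proof (rule Bochner_Integration.integrable_bound)
    show "integrable mu (\<lambda>x. 1 + norm (f x) powr enn2real p)"
      using assms False by (simp add: Leb_def vilenkin_Lp_def)
    show "AE x in mu. norm (f x) \<le> norm (1 + norm (f x) powr enn2real p)"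
      using powr_le_1_plus[OF enn2real_ge_1[OF False], of "norm (f _)"] by (auto simp: add_nonneg_nonneg)
  qed (use Leb_measurable[OF assms] in simp)
qed

lemma Leb_bounded:
  assumes "f \<in> borel_measurable mu" "\<And>x. x \<in> G \<Longrightarrow> norm (f x) \<le> C"
  shows "f \<in> Leb p"
proof (cases "p = \<infinity>")
  case True
  then show ?thesis using assms by (auto simp: Leb_def)
next
  case False
  have "integrable mu (\<lambda>x. norm (f x) powr enn2real p)"
  proof (rule integrable_bounded)
    show "(\<lambda>x. norm (f x) powr enn2real p) \<in> borel_measurable mu" using assms by simp
    show "norm (norm (f x) powr enn2real p) \<le> C powr enn2real p" if "x \<in> G" for x
      using assms(2)[OF that] by (simp add: powr_mono2)
  qed
  then show ?thesis using assms False by (simp add: Leb_def vilenkin_Lp_def)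
qed

lemma Leb_add:
  assumes f: "f \<in> Leb p" and g: "g \<in> Leb p"
  shows "(\<lambda>x. f x + g x) \<in> Leb p"
proof -
  note [measurable] = Leb_measurable[OF f] Leb_measurable[OF g]
  show ?thesis
  proof (cases "p = \<infinity>")
    case True
    obtain C D where "\<forall>x\<in>G. norm (f x) \<le> C" "\<forall>x\<in>G. norm (g x) \<le> D"
      using f g True by (auto simp: Leb_def)
    then have "norm (f x + g x) \<le> C + D" if "x \<in> G" for x
      using that by (intro order_trans[OF norm_triangle_ineq] add_mono) auto
    then show ?thesis by (intro Leb_bounded[of _ "C + D"]) auto
  next
    case False
    define q where "q = enn2real p"
    have q: "1 \<le> q" unfolding q_def by (rule enn2real_ge_1[OF False])
    have "integrable mu (\<lambda>x. norm (f x + g x) powr q)"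
    proof (rule Bochner_Integration.integrable_bound)
      show "integrable mu (\<lambda>x. 2 powr q * (norm (f x) powr q + norm (g x) powr q))"
        using f g False by (simp add: Leb_def vilenkin_Lp_def q_def)
      show "AE x in mu. norm (norm (f x + g x) powr q)
          \<le> norm (2 powr q * (norm (f x) powr q + norm (g x) powr q))"
      proof (rule AE_I2)
        fix x
        have "norm (f x + g x) powr q \<le> (2 * (1 / 2 * norm (f x) + (1 - 1 / 2) * norm (g x))) powr q"
          using norm_triangle_ineq[of "f x" "g x"] q by (intro powr_mono2) auto
        also have "\<dots> = 2 powr q * (1 / 2 * norm (f x) + (1 - 1 / 2) * norm (g x)) powr q"
          by (rule powr_mult)
        also have "\<dots> \<le> 2 powr q * (1 / 2 * norm (f x) powr q + (1 - 1 / 2) * norm (g x) powr q)"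
          by (intro mult_left_mono powr_convex q) auto
        also have "\<dots> \<le> 2 powr q * (norm (f x) powr q + norm (g x) powr q)"
        proof (rule mult_left_mono)
          show "1 / 2 * norm (f x) powr q + (1 - 1 / 2) * norm (g x) powr q
              \<le> norm (f x) powr q + norm (g x) powr q"
            by (intro add_mono mult_left_le_one_le) auto
        qed simp
        finally show "norm (norm (f x + g x) powr q)
            \<le> norm (2 powr q * (norm (f x) powr q + norm (g x) powr q))"
          by simp
      qed
    qed simp
    then show ?thesis using False by (simp add: Leb_def vilenkin_Lp_def q_def)
  qed
qed

lemma Leb_minus: "f \<in> Leb p \<Longrightarrow> (\<lambda>x. - f x) \<in> Leb p"
  by (auto simp: Leb_def vilenkin_Lp_def split: if_splits)

lemma Leb_diff: "f \<in> Leb p \<Longrightarrow> g \<in> Leb p \<Longrightarrow> (\<lambda>x. f x - g x) \<in> Leb p"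
  using Leb_add[OF _ Leb_minus, of f g] by simp

lemma Leb_shift:
  assumes "f \<in> Leb p"
  shows "(\<lambda>x. f (x \<boxplus> h)) \<in> Leb p"
proof -
  have meas: "(\<lambda>x. f (x \<boxplus> h)) \<in> borel_measurable mu"
    by (rule measurable_compose[OF measurable_shift Leb_measurable[OF assms]])
  show ?thesis
  proof (cases "p = \<infinity>")
    case True
    then obtain C where "\<forall>x\<in>G. norm (f x) \<le> C" using assms by (auto simp: Leb_def)
    then show ?thesis by (intro Leb_bounded[OF meas, of C]) simp
  next
    case False
    then have "integrable mu (\<lambda>x. norm (f (x \<boxplus> h)) powr enn2real p)"
      using assms integrable_shift[of "\<lambda>x. norm (f x) powr enn2real p" h]
      by (simp add: Leb_def vilenkin_Lp_def)
    then show ?thesis using False meas by (simp add: Leb_def vilenkin_Lp_def)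
  qed
qed

lemma norm_le_N_infty:
  assumes "p = \<infinity>" "f \<in> Leb p" "x \<in> G"
  shows "norm (f x) \<le> N p f"
proof -
  obtain C where "\<forall>x\<in>G. norm (f x) \<le> C" using assms by (auto simp: Leb_def)
  then have "norm (f x) \<le> (SUP x\<in>G. norm (f x))"
    by (intro cSUP_upper assms) (auto intro: bdd_aboveI2)
  then show ?thesis using assms(1) by (simp add: vilenkin_norm_def)
qed

lemma N_infty_le: "p = \<infinity> \<Longrightarrow> (\<And>x. x \<in> G \<Longrightarrow> norm (f x) \<le> C) \<Longrightarrow> N p f \<le> C"
  unfolding vilenkin_norm_def by (simp add: cSUP_least G_nonempty)

lemma N_nonneg:
  assumes "f \<in> Leb p"
  shows "0 \<le> N p f"
proof (cases "p = \<infinity>")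
  case True
  obtain x where x: "x \<in> G" using G_nonempty by blast
  have "0 \<le> norm (f x)" by simp
  also have "\<dots> \<le> N p f" by (rule norm_le_N_infty[OF True assms x])
  finally show ?thesis .
qed (simp add: vilenkin_norm_def)

lemma N_powr:
  assumes "p \<noteq> \<infinity>"
  shows "(LINT x|mu. norm (f x) powr enn2real p) = N p f powr enn2real p"
  using assms enn2real_ge_1[OF assms] by (simp add: vilenkin_norm_def powr_powr)

lemma N_le_powr:
  assumes "p \<noteq> \<infinity>" "0 \<le> C" "(LINT x|mu. norm (f x) powr enn2real p) \<le> C powr enn2real p"
  shows "N p f \<le> C"
proof -
  have "N p f \<le> (C powr enn2real p) powr (1 / enn2real p)"
    using assms by (simp add: vilenkin_norm_def powr_mono2)
  also have "\<dots> = C" using assms enn2real_ge_1[OF assms(1)] by (simp add: powr_powr)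
  finally show ?thesis .
qed

lemma N_shift:
  assumes "f \<in> Leb p"
  shows "N p (\<lambda>x. f (x \<boxplus> h)) \<le> N p f"
proof (cases "p = \<infinity>")
  case True
  show ?thesis
    by (rule N_infty_le[OF True]) (rule norm_le_N_infty[OF True assms add_in_G])
next
  case False
  note [measurable] = Leb_measurable[OF assms]
  have "(LINT x|mu. norm (f (x \<boxplus> h)) powr enn2real p) = (LINT x|mu. norm (f x) powr enn2real p)"
    by (rule integral_shift) measurable
  then show ?thesis using False by (simp add: vilenkin_norm_def)
qed

lemma N_triangle:
  assumes f: "f \<in> Leb p" and g: "g \<in> Leb p"
  shows "N p (\<lambda>x. f x + g x) \<le> N p f + N p g"
proof (cases "p = \<infinity>")
  case True
  have "norm (f x + g x) \<le> N p f + N p g" if "x \<in> G" for x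
    using norm_le_N_infty[OF True _ that] f g by (intro order_trans[OF norm_triangle_ineq] add_mono) auto
  then show ?thesis by (rule N_infty_le[OF True])
next
  case False
  define q where "q = enn2real p"
  have q: "1 \<le> q" unfolding q_def by (rule enn2real_ge_1[OF False])
  have intf: "integrable mu (\<lambda>x. norm (f x) powr q)" and intg: "integrable mu (\<lambda>x. norm (g x) powr q)"
    using f g False by (auto simp: Leb_def vilenkin_Lp_def q_def)
  \<comment> \<open>By convexity for \<open>f / a\<close> and \<open>g / b\<close> with weights proportional to \<open>a\<close> and \<open>b\<close>.  Numbers strictly above
    the norms avoid division by \<open>0\<close>.\<close>
  have le: "N p (\<lambda>x. f x + g x) \<le> a + b" if a: "N p f < a" and b: "N p g < b" for a b
  proof -
    have a0: "0 < a" and b0: "0 < b" using a b N_nonneg[OF f] N_nonneg[OF g] by linarith+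
    define t where "t = a / (a + b)"
    have t: "0 \<le> t" "t \<le> 1" "1 - t = b / (a + b)" using a0 b0 by (auto simp: t_def field_simps)
    have "(LINT x|mu. norm (f x + g x) powr q)
        \<le> (LINT x|mu. (a + b) powr q * (t * (norm (f x) powr q / a powr q) + (1 - t) * (norm (g x) powr q / b powr q)))"
    proof (rule integral_mono')
      show "integrable mu (\<lambda>x. (a + b) powr q * (t * (norm (f x) powr q / a powr q) + (1 - t) * (norm (g x) powr q / b powr q)))"
        using intf intg by simp
      fix x
      have "t * (norm (f x) / a) + (1 - t) * (norm (g x) / b) = (norm (f x) + norm (g x)) / (a + b)"
        unfolding t(3) using a0 b0 by (simp add: t_def add_divide_distrib)
      then have "norm (f x + g x) \<le> (a + b) * (t * (norm (f x) / a) + (1 - t) * (norm (g x) / b))"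
        using a0 b0 by (simp add: norm_triangle_ineq)
      then have "norm (f x + g x) powr q \<le> ((a + b) * (t * (norm (f x) / a) + (1 - t) * (norm (g x) / b))) powr q"
        using q by (intro powr_mono2) auto
      also have "\<dots> = (a + b) powr q * (t * (norm (f x) / a) + (1 - t) * (norm (g x) / b)) powr q"
        by (rule powr_mult)
      also have "\<dots> \<le> (a + b) powr q * (t * (norm (f x) / a) powr q + (1 - t) * (norm (g x) / b) powr q)"
        using a0 b0 t by (intro mult_left_mono powr_convex q) auto
      finally show "norm (f x + g x) powr q
          \<le> (a + b) powr q * (t * (norm (f x) powr q / a powr q) + (1 - t) * (norm (g x) powr q / b powr q))"
        using a0 b0 by (simp add: powr_divide)
      show "0 \<le> (a + b) powr q * (t * (norm (f x) powr q / a powr q) + (1 - t) * (norm (g x) powr q / b powr q))"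
        using t by (intro mult_nonneg_nonneg add_nonneg_nonneg) auto
    qed
    also have "\<dots> = (a + b) powr q * (t * (N p f powr q / a powr q) + (1 - t) * (N p g powr q / b powr q))"
      using intf intg N_powr[OF False] by (simp add: q_def)
    also have "\<dots> \<le> (a + b) powr q * (t * 1 + (1 - t) * 1)"
    proof (intro mult_left_mono add_mono)
      show "N p f powr q / a powr q \<le> 1" "N p g powr q / b powr q \<le> 1"
        using a b a0 b0 q N_nonneg[OF f] N_nonneg[OF g] by (auto simp: powr_mono2)
    qed (use t in auto)
    finally have "(LINT x|mu. norm (f x + g x) powr q) \<le> (a + b) powr q" by simp
    then show ?thesis using N_le_powr[OF False, of "a + b"] a0 b0 by (simp add: q_def)
  qed
  show ?thesis
  proof (rule field_le_epsilon)
    fix e :: real assume "0 < e"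
    then show "N p (\<lambda>x. f x + g x) \<le> N p f + N p g + e"
      using le[of "N p f + e / 2" "N p g + e / 2"] by simp
  qed
qed

lemma N_minus: "N p (\<lambda>x. - f x) = N p f"
  by (rule N_cong) simp

lemma N_triangle_diff:
  assumes "f \<in> Leb p" "g \<in> Leb p"
  shows "N p (\<lambda>x. f x - g x) \<le> N p f + N p g"
  using N_triangle[OF assms(1) Leb_minus[OF assms(2)]] by (simp add: N_minus)

lemma N_sum:
  fixes n :: nat
  assumes "\<And>i. i < n \<Longrightarrow> f i \<in> Leb p"
  shows "(\<lambda>x. \<Sum>i<n. f i x) \<in> Leb p \<and> N p (\<lambda>x. \<Sum>i<n. f i x) \<le> (\<Sum>i<n. N p (f i))"
  using assms
proof (induction n)
  case 0
  have "N p (\<lambda>x. 0) \<le> 0"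
  proof (cases "p = \<infinity>")
    case True
    show ?thesis by (rule N_infty_le[OF True]) simp
  qed (simp add: vilenkin_norm_def)
  then show ?case by (auto intro: Leb_bounded[of _ 0])
next
  case (Suc n)
  then have IH: "(\<lambda>x. \<Sum>i<n. f i x) \<in> Leb p" "N p (\<lambda>x. \<Sum>i<n. f i x) \<le> (\<Sum>i<n. N p (f i))"
    and fn: "f n \<in> Leb p" by auto
  show ?case using Leb_add[OF IH(1) fn] N_triangle[OF IH(1) fn] IH(2) by simp
qed

lemma N_integral_le:
  assumes R: "0 \<le> R"
    and F: "case_prod F \<in> borel_measurable (mu \<Otimes>\<^sub>M mu)"
    and g: "integrable mu g"
    and FR: "\<And>u. u \<in> G \<Longrightarrow> g u \<noteq> 0 \<Longrightarrow> F u \<in> Leb p \<and> N p (F u) \<le> R"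
  shows "N p (\<lambda>x. LINT u|mu. F u x * g u) \<le> L1 g * R"
proof (cases "p = \<infinity>")
  case True
  have "norm (LINT u|mu. F u x * g u) \<le> L1 g * R" if x: "x \<in> G" for x
  proof -
    have "norm (LINT u|mu. F u x * g u) \<le> (LINT u|mu. norm (F u x * g u))"
      by (rule integral_norm_bound)
    also have "\<dots> \<le> (LINT u|mu. norm (g u) * R)"
    proof (rule integral_mono')
      fix u assume "u \<in> space mu"
      then have u: "u \<in> G" by (simp add: space_mu)
      show "norm (F u x * g u) \<le> norm (g u) * R"
      proof (cases "g u = 0")
        case False
        then have "norm (F u x) \<le> R"
          using FR[OF u] norm_le_N_infty[OF True, of "F u" x] x by force
        then show ?thesis 
            using mult_left_mono[of "norm (F u x)" R "norm (g u)"] by (simp add: norm_mult mult.commute)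
      qed simp
    qed (use g R in auto)
    finally show ?thesis by (simp add: L1_def)
  qed
  then show ?thesis by (rule N_infty_le[OF True])
next
  case False
  show ?thesis
  proof (rule N_le_powr[OF False])
    show "(LINT x|mu. norm (LINT u|mu. F u x * g u) powr enn2real p) \<le> (L1 g * R) powr enn2real p"
      unfolding L1_def
    proof (rule mu_pair.minkowski_integral_powr[OF enn2real_ge_1[OF False] R F g])
      fix u assume "u \<in> space mu" "g u \<noteq> 0"
      then have "F u \<in> Leb p" "N p (F u) \<le> R" using FR by (auto simp: space_mu)
      then show "integrable mu (\<lambda>x. norm (F u x) powr enn2real p)
          \<and> (LINT x|mu. norm (F u x) powr enn2real p) \<le> R powr enn2real p"
        using False N_nonneg[of "F u"] enn2real_ge_1[OF False]
        by (auto simp: Leb_def vilenkin_Lp_def N_powr powr_mono2)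
    qed
  qed (use R in simp)
qed

end

end

section \<open>Multipliers as convolutions\<close>

context vilenkin
begin

abbreviation coeff :: "((nat \<Rightarrow> int) \<Rightarrow> complex) \<Rightarrow> nat \<Rightarrow> complex"
  where "coeff \<equiv> vilenkin_fourier_coeff m"

text \<open>Partial sums, Cesaro means and the deviation between them are all of this form, with finitely many
  nonzero weights.\<close>

definition multiplier :: "(nat \<Rightarrow> real) \<Rightarrow> nat \<Rightarrow> ((nat \<Rightarrow> int) \<Rightarrow> complex) \<Rightarrow> (nat \<Rightarrow> int) \<Rightarrow> complex" where
  "multiplier a L f x = (\<Sum>l<L. of_real (a l) * coeff f l * psi l x)"

abbreviation partial_M :: "nat \<Rightarrow> ((nat \<Rightarrow> int) \<Rightarrow> complex) \<Rightarrow> (nat \<Rightarrow> int) \<Rightarrow> complex" where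
  "partial_M k \<equiv> multiplier (\<lambda>_. 1) (M k)"

lemma cesaro_mean_eq_multiplier:
  "cesaro_mean m b n f = multiplier (\<lambda>l. cesaro_number b (n - l) / cesaro_number b n) (Suc n) f"
  unfolding cesaro_mean_def[abs_def] multiplier_def[abs_def] sum_distrib_left lessThan_Suc_atMost
  by (intro ext sum.cong) (auto simp: divide_simps)

lemma integrable_times_cnj_psi:
  fixes f :: "(nat \<Rightarrow> int) \<Rightarrow> complex"
  assumes "integrable mu f"
  shows "integrable mu (\<lambda>u. f u * cnj (psi l u))"
  using integrable_mult_unimodular[OF assms, of "\<lambda>u. cnj (psi l u)"] by (simp add: mult.commute)

lemma integrable_shift':
  fixes f :: "(nat \<Rightarrow> int) \<Rightarrow> complex"
  shows "integrable mu f \<Longrightarrow> integrable mu (\<lambda>u. f (x \<boxplus> u))"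
  using integrable_shift[of f x] by (simp add: add_commute[of x])

lemma coeff_psi_eq_convolution:
  assumes "integrable mu f"
  shows "coeff f l * psi l x = (LINT u|mu. f (x \<boxplus> u) * cnj (psi l u))"
proof -
  have [measurable]: "f \<in> borel_measurable mu" using assms by simp
  have "coeff f l = (LINT u|mu. f (u \<boxplus> x) * cnj (psi l (u \<boxplus> x)))"
    unfolding vilenkin_fourier_coeff_def
    by (rule integral_shift[symmetric, where f = "\<lambda>u. f u * cnj (psi l u)"]) measurable
  also have "\<dots> = (LINT u|mu. cnj (psi l x) * (f (x \<boxplus> u) * cnj (psi l u)))"
    unfolding add_commute[of _ x] psi_add by (simp add: ac_simps)
  also have "\<dots> = cnj (psi l x) * (LINT u|mu. f (x \<boxplus> u) * cnj (psi l u))" by simp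
  finally show ?thesis by (simp add: ac_simps)
qed

lemma multiplier_eq_convolution:
  assumes "integrable mu f"
  shows "multiplier a L f x = (LINT u|mu. f (x \<boxplus> u) * cnj (trig a L u))"
proof -
  have "multiplier a L f x = (\<Sum>l<L. LINT u|mu. of_real (a l) * (f (x \<boxplus> u) * cnj (psi l u)))"
    unfolding multiplier_def mult.assoc coeff_psi_eq_convolution[OF assms] by simp
  also have "\<dots> = (LINT u|mu. (\<Sum>l<L. of_real (a l) * (f (x \<boxplus> u) * cnj (psi l u))))"
    using integrable_times_cnj_psi[OF integrable_shift'[OF assms]] by (simp add: Bochner_Integration.integral_sum)
  finally show ?thesis by (simp add: trig_def sum_distrib_left ac_simps)
qed

lemma measurable_shift_pair:
  assumes "f \<in> borel_measurable mu"
  shows "(\<lambda>(u, x). f (x \<boxplus> u)) \<in> borel_measurable (mu \<Otimes>\<^sub>M mu)"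
  using measurable_compose[OF measurable_add assms] by (simp add: case_prod_beta' add_commute)

lemma trig_one: "trig (\<lambda>_. 1) L = dirichlet L"
  by (rule ext) (simp add: trig_def dirichlet_def)

lemma L1_cnj: "L1 (\<lambda>u. cnj (g u)) = L1 g"
  by (simp add: L1_def)

context
  fixes p :: ennreal and f :: "(nat \<Rightarrow> int) \<Rightarrow> complex"
  assumes p1: "1 \<le> p" and f: "f \<in> Leb p"
begin

lemma multiplier_in_Leb: "multiplier a L g \<in> Leb p"
proof (rule Leb_bounded[OF p1])
  show "multiplier a L g \<in> borel_measurable mu" unfolding multiplier_def[abs_def] by measurable
  show "norm (multiplier a L g x) \<le> (\<Sum>l<L. norm (of_real (a l) * coeff g l))" for x
    unfolding multiplier_def by (rule order_trans[OF norm_sum]) (simp add: norm_mult)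
qed

text \<open>Young's inequality, obtained from Minkowski's because translates of \<open>f\<close> have norm at most that of \<open>f\<close>.\<close>

lemma N_multiplier_le: "N p (multiplier a L f) \<le> L1 (trig a L) * N p f"
proof -
  have "N p (\<lambda>x. LINT u|mu. f (x \<boxplus> u) * cnj (trig a L u)) \<le> L1 (\<lambda>u. cnj (trig a L u)) * N p f"
  proof (rule N_integral_le[OF p1])
    show "(\<lambda>(u, x). f (x \<boxplus> u)) \<in> borel_measurable (mu \<Otimes>\<^sub>M mu)"
      by (rule measurable_shift_pair[OF Leb_measurable[OF p1 f]])
  qed (use Leb_shift[OF p1 f] N_shift[OF p1 f] N_nonneg[OF p1 f] in auto)
  then show ?thesis
    by (simp add: L1_cnj multiplier_eq_convolution[OF Leb_integrable[OF p1 f], abs_def])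
qed

lemma modulus_upper:
  assumes "h \<in> vilenkin_I m k"
  shows "N p (\<lambda>x. f (x \<boxplus> h) - f x) \<le> vilenkin_modulus m p k f"
  unfolding vilenkin_modulus_def
  \<comment> \<open>The supremum is a real number, so it is an upper bound only once the set is known to be bounded.\<close>
proof (rule cSUP_upper[OF assms bdd_aboveI2])
  fix h
  have "N p (\<lambda>x. f (x \<boxplus> h) - f x) \<le> N p (\<lambda>x. f (x \<boxplus> h)) + N p f"
    by (rule N_triangle_diff[OF p1 Leb_shift[OF p1 f] f])
  then show "N p (\<lambda>x. f (x \<boxplus> h) - f x) \<le> 2 * N p f" using N_shift[OF p1 f, of h] by simp
qed

lemma modulus_nonneg: "0 \<le> vilenkin_modulus m p k f"
proof -
  have "(\<lambda>_. 0) \<in> vilenkin_I m k" by (simp add: vilenkin_I_def in_G_iff)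
  from modulus_upper[OF this] show ?thesis
    using N_nonneg[OF p1 Leb_diff[OF p1 Leb_shift[OF p1 f] f]] by (rule order_trans[rotated])
qed

text \<open>The kernel \<open>D\<close> of order \<open>M\<^sub>k\<close> has mean \<open>1\<close> and vanishes off the subgroup \<open>I\<^sub>k\<close>, so the
  partial sum of order \<open>M\<^sub>k\<close> averages the translates of \<open>f\<close> by elements of \<open>I\<^sub>k\<close>.\<close>

lemma N_partial_M_le: "N p (\<lambda>x. f x - partial_M k f x) \<le> vilenkin_modulus m p k f"
proof -
  have int: "integrable mu f" by (rule Leb_integrable[OF p1 f])
  have mf: "f \<in> borel_measurable mu" by (rule Leb_measurable[OF p1 f])
  let ?D = "\<lambda>u. cnj (dirichlet (M k) u)"
  have diff: "partial_M k f x - f x = (LINT u|mu. (f (x \<boxplus> u) - f x) * ?D u)" for x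
  proof -
    have i: "integrable mu (\<lambda>u. f (x \<boxplus> u) * ?D u)"
      unfolding dirichlet_def cnj_sum sum_distrib_left
      by (intro Bochner_Integration.integrable_sum integrable_times_cnj_psi integrable_shift' int)
    have "(LINT u|mu. (f (x \<boxplus> u) - f x) * ?D u)
        = (LINT u|mu. f (x \<boxplus> u) * ?D u) - (LINT u|mu. f x * ?D u)"
      unfolding left_diff_distrib by (rule Bochner_Integration.integral_diff) (use i in auto)
    moreover have "(LINT u|mu. ?D u) = 1" using integral_dirichlet[of "M k"] by simp
    ultimately show ?thesis by (simp add: multiplier_eq_convolution[OF int] trig_one)
  qed
  have "N p (\<lambda>x. f x - partial_M k f x) = N p (\<lambda>x. LINT u|mu. (f (x \<boxplus> u) - f x) * ?D u)"
    unfolding diff[symmetric] by (rule N_cong) (simp add: norm_minus_commute)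
  also have "\<dots> \<le> L1 ?D * vilenkin_modulus m p k f"
  proof (rule N_integral_le[OF p1 modulus_nonneg])
    have "(\<lambda>(u, x). f x) \<in> borel_measurable (mu \<Otimes>\<^sub>M mu)"
      using measurable_compose[OF measurable_snd mf] by (simp add: case_prod_beta')
    with measurable_shift_pair[OF mf] show "(\<lambda>(u, x). f (x \<boxplus> u) - f x) \<in> borel_measurable (mu \<Otimes>\<^sub>M mu)"
      unfolding case_prod_beta' by (rule borel_measurable_diff)
    fix u assume u: "u \<in> G" "?D u \<noteq> 0"
    then have "u \<in> vilenkin_I m k" by (auto simp: vilenkin_I_def dirichlet_M split: if_splits)
    then show "(\<lambda>x. f (x \<boxplus> u) - f x) \<in> Leb p \<and> N p (\<lambda>x. f (x \<boxplus> u) - f x) \<le> vilenkin_modulus m p k f"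
      using modulus_upper Leb_diff[OF p1 Leb_shift[OF p1 f] f] by blast
  qed simp
  finally show ?thesis by (simp add: L1_cnj L1_dirichlet_M)
qed

lemma coeff_partial_M:
  "coeff (\<lambda>x. f x - partial_M k f x) l = (if l < M k then 0 else coeff f l)"
proof -
  have int: "integrable mu f" by (rule Leb_integrable[OF p1 f])
  have "(LINT x|mu. partial_M k f x * cnj (psi l x))
      = (\<Sum>i<M k. LINT x|mu. coeff f i * (psi i x * cnj (psi l x)))"
    unfolding multiplier_def sum_distrib_right
    by (subst Bochner_Integration.integral_sum)
      (auto simp: mult.assoc intro!: integrable_times_cnj_psi)
  also have "\<dots> = (\<Sum>i<M k. if i = l then coeff f l else 0)"
    by (intro sum.cong refl) (simp add: psi_inner)
  also have "\<dots> = (if l < M k then coeff f l else 0)" by simp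
  finally have "(LINT x|mu. partial_M k f x * cnj (psi l x)) = (if l < M k then coeff f l else 0)" .
  moreover have "coeff (\<lambda>x. f x - partial_M k f x) l
      = coeff f l - (LINT x|mu. partial_M k f x * cnj (psi l x))"
    unfolding vilenkin_fourier_coeff_def left_diff_distrib
    by (rule Bochner_Integration.integral_diff)
      (intro integrable_times_cnj_psi int Leb_integrable[OF p1 multiplier_in_Leb])+
  ultimately show ?thesis by simp
qed

lemma multiplier_diff_partial_M:
  assumes "M k \<le> L"
  shows "multiplier a L (\<lambda>x. f x - partial_M k f x) x = multiplier a L f x - multiplier a (M k) f x"
proof -
  have "multiplier a L (\<lambda>x. f x - partial_M k f x) x
      = (\<Sum>l<L. if l < M k then 0 else of_real (a l) * coeff f l * psi l x)"
    unfolding multiplier_def[of a] coeff_partial_M by (intro sum.cong) auto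
  also have "\<dots> = (\<Sum>l\<in>{..<L} - {..<M k}. of_real (a l) * coeff f l * psi l x)"
    by (rule sum.mono_neutral_cong_right) auto
  also have "\<dots> = multiplier a L f x - multiplier a (M k) f x"
    unfolding multiplier_def[of a] using assms by (intro sum_diff) auto
  finally show ?thesis .
qed

end

end

section \<open>Convergence\<close>

context bounded_vilenkin
begin

text \<open>The error is split at the frequency \<open>M\<^sub>K \<le> n / 2\<close>.  From there on, the mean and the identity act
  on the remainder \<open>f - S\<^sub>K f\<close>.  Below it, the weights deviate little from \<open>1\<close>; on the band from
  \<open>M\<^sub>j\<close> to \<open>M\<^sub>j\<^sub>+\<^sub>1\<close> the deviation acts on the remainder \<open>f - S\<^sub>j f\<close>, whose Fourier coefficients
  vanish below that band and agree with those of \<open>f\<close> on it.\<close>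

lemma N_cesaro_error_le:
  fixes a :: real
  assumes a: "0 < a" "a < 1"
  obtains C where "0 < C"
    "\<And>p f n K. \<lbrakk>1 \<le> p; f \<in> Leb p; 2 * M K \<le> n\<rbrakk> \<Longrightarrow>
      N p (\<lambda>x. cesaro_mean m (- a) n f x - f x)
        \<le> (C * real (n + 1) powr a + 1) * vilenkin_modulus m p K f
          + (\<Sum>j<K. C * real (M (Suc j)) powr (1 + a / 2) / real (n + 1) * vilenkin_modulus m p j f)"
proof -
  obtain C1 where C1: "0 < C1" "\<And>n. L1 (trig (\<lambda>l. cesaro_number (- a) (n - l)) (Suc n)) \<le> C1"
    by (rule L1_cesaro_kernel[OF a]) blast
  obtain C2 where C2: "0 < C2"
    "\<And>n L. \<lbrakk>0 < L; 2 * L \<le> n\<rbrakk> \<Longrightarrow>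
      L1 (trig (\<lambda>l. cesaro_number (- a) (n - l) / cesaro_number (- a) n - 1) L)
        \<le> C2 * real L powr (1 + a / 2) / real (n + 1)"
    by (rule L1_cesaro_deviation[OF a]) blast
  define C where "C = max (C1 / (1 - a)) C2"
  have C: "0 < C" "C1 / (1 - a) \<le> C" "C2 \<le> C" using C2 by (auto simp: C_def)
  have "N p (\<lambda>x. cesaro_mean m (- a) n f x - f x)
        \<le> (C * real (n + 1) powr a + 1) * vilenkin_modulus m p K f
          + (\<Sum>j<K. C * real (M (Suc j)) powr (1 + a / 2) / real (n + 1) * vilenkin_modulus m p j f)"
    if p1: "1 \<le> p" and f: "f \<in> Leb p" and n: "2 * M K \<le> n" for p f n K
  proof -
    define w where "w l = cesaro_number (- a) (n - l) / cesaro_number (- a) n" for l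
    define d where "d l = w l - 1" for l
    define rest where "rest j x = f x - partial_M j f x" for j x
    define om where "om j = vilenkin_modulus m p j f" for j
    have An: "0 < cesaro_number (- a) n" by (rule cesaro_number_pos[OF a])
    have d0: "d 0 = 0" using An by (simp add: d_def w_def)
    have rest: "rest j \<in> Leb p" "N p (rest j) \<le> om j" for j
      unfolding rest_def[abs_def] om_def
      by (intro Leb_diff[OF p1] f multiplier_in_Leb[OF p1 f] N_partial_M_le[OF p1 f])+
    have om0: "0 \<le> om j" for j unfolding om_def by (rule modulus_nonneg[OF p1 f])
    \<comment> \<open>The sum over the bands telescopes; frequency \<open>0\<close> belongs to no band, but its weight \<open>d 0\<close> vanishes.\<close>
    have low: "(\<Sum>j<K. multiplier d (M (Suc j)) (rest j) x) = multiplier d (M K) f x" for x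
    proof -
      have "(\<Sum>j<K. multiplier d (M (Suc j)) (rest j) x)
          = (\<Sum>j<K. multiplier d (M (Suc j)) f x - multiplier d (M j) f x)"
        unfolding rest_def[abs_def]
        by (intro sum.cong refl multiplier_diff_partial_M[OF p1 f] M_mono) simp
      also have "\<dots> = multiplier d (M K) f x - multiplier d (M 0) f x"
        by (rule sum_lessThan_telescope)
      also have "multiplier d (M 0) f x = 0" by (simp add: multiplier_def d0)
      finally show ?thesis by simp
    qed
    have decomp: "cesaro_mean m (- a) n f x - f x
        = (multiplier w (Suc n) (rest K) x - rest K x) + (\<Sum>j<K. multiplier d (M (Suc j)) (rest j) x)" for x
    proof -
      have "multiplier w (Suc n) (rest K) x = multiplier w (Suc n) f x - multiplier w (M K) f x"
        unfolding rest_def[abs_def] by (rule multiplier_diff_partial_M[OF p1 f]) (use n in simp)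
      moreover have "multiplier d (M K) f x = multiplier w (M K) f x - partial_M K f x"
        by (simp add: multiplier_def d_def sum_subtractf algebra_simps)
      ultimately show ?thesis
        unfolding low by (simp add: cesaro_mean_eq_multiplier w_def[abs_def] rest_def)
    qed
    have high: "N p (multiplier w (Suc n) (rest K)) \<le> C * real (n + 1) powr a * om K"
    proof -
      have "L1 (trig w (Suc n)) = L1 (\<lambda>u. of_real (1 / cesaro_number (- a) n) * trig (\<lambda>l. cesaro_number (- a) (n - l)) (Suc n) u)"
        unfolding trig_def w_def sum_distrib_left by simp
      also have "\<dots> = 1 / cesaro_number (- a) n * L1 (trig (\<lambda>l. cesaro_number (- a) (n - l)) (Suc n))"
        using An by (simp only: L1_scale norm_of_real) simp
      also have "\<dots> \<le> real (n + 1) powr a / (1 - a) * C1"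
      proof (rule mult_mono[OF _ C1(2)])
        show "1 / cesaro_number (- a) n \<le> real (n + 1) powr a / (1 - a)"
          using cesaro_number_lower[OF a, of n] An a by (simp add: powr_minus field_simps)
      qed (use a in auto)
      also have "\<dots> = C1 / (1 - a) * real (n + 1) powr a" by simp
      also have "\<dots> \<le> C * real (n + 1) powr a" by (rule mult_right_mono[OF C(2)]) simp
      finally have "L1 (trig w (Suc n)) \<le> C * real (n + 1) powr a" .
      then have "L1 (trig w (Suc n)) * N p (rest K) \<le> C * real (n + 1) powr a * om K"
        using rest C N_nonneg[OF p1 rest(1)] by (intro mult_mono) auto
      then show ?thesis using N_multiplier_le[OF p1 rest(1)] by (rule order_trans[rotated])
    qed
    have band: "N p (multiplier d (M (Suc j)) (rest j))
        \<le> C * real (M (Suc j)) powr (1 + a / 2) / real (n + 1) * om j" if j: "j < K" for j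
    proof -
      have "2 * M (Suc j) \<le> n" using M_mono[of "Suc j" K] j n by linarith
      then have "L1 (trig d (M (Suc j))) \<le> C2 * real (M (Suc j)) powr (1 + a / 2) / real (n + 1)"
        unfolding d_def[abs_def] w_def by (intro C2(2)) (rule M_pos)
      also have "\<dots> \<le> C * real (M (Suc j)) powr (1 + a / 2) / real (n + 1)"
        using C by (intro divide_right_mono mult_right_mono) auto
      finally have "L1 (trig d (M (Suc j))) * N p (rest j)
          \<le> C * real (M (Suc j)) powr (1 + a / 2) / real (n + 1) * om j"
        using rest C N_nonneg[OF p1 rest(1)] by (intro mult_mono) auto
      then show ?thesis using N_multiplier_le[OF p1 rest(1)] by (rule order_trans[rotated])
    qed
    have sum: "(\<lambda>x. \<Sum>j<K. multiplier d (M (Suc j)) (rest j) x) \<in> Leb p"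
      "N p (\<lambda>x. \<Sum>j<K. multiplier d (M (Suc j)) (rest j) x) \<le> (\<Sum>j<K. N p (multiplier d (M (Suc j)) (rest j)))"
      using N_sum[OF p1, of K "\<lambda>j. multiplier d (M (Suc j)) (rest j)"] multiplier_in_Leb[OF p1 f] by auto
    have "N p (\<lambda>x. cesaro_mean m (- a) n f x - f x)
        \<le> N p (\<lambda>x. multiplier w (Suc n) (rest K) x - rest K x)
          + N p (\<lambda>x. \<Sum>j<K. multiplier d (M (Suc j)) (rest j) x)"
      unfolding decomp
      by (intro N_triangle[OF p1] Leb_diff[OF p1] multiplier_in_Leb[OF p1 f] rest sum)
    also have "N p (\<lambda>x. multiplier w (Suc n) (rest K) x - rest K x)
        \<le> N p (multiplier w (Suc n) (rest K)) + N p (rest K)"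
      by (rule N_triangle_diff[OF p1 multiplier_in_Leb[OF p1 f] rest(1)])
    also have "\<dots> \<le> C * real (n + 1) powr a * om K + om K"
      by (rule add_mono[OF high rest(2)])
    also have "N p (\<lambda>x. \<Sum>j<K. multiplier d (M (Suc j)) (rest j) x)
        \<le> (\<Sum>j<K. C * real (M (Suc j)) powr (1 + a / 2) / real (n + 1) * om j)"
      by (rule order_trans[OF sum(2) sum_mono]) (use band in auto)
    finally show ?thesis by (simp add: om_def algebra_simps)
  qed
  then show ?thesis using that C(1) by blast
qed

text \<open>For \<open>M\<^sub>k \<le> n < M\<^sub>k\<^sub>+\<^sub>1\<close> the previous estimate with \<open>K = k - 1\<close> bounds the error by a multiple of the
  \<open>k\<close>-th term of the hypothesis plus the contribution of the bands.  An upper bound \<open>W\<close>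
  for all terms of the hypothesis controls the latter, because it bounds the modulus at \<open>1 / M\<^sub>j\<close> by
  \<open>W\<close> times \<open>M\<^sub>j\<^sub>+\<^sub>1\<close> to the power \<open>- a\<close>.\<close>

lemma cesaro_mean_tendsto:
  fixes a :: real
  assumes a: "0 < a" "a < 1" and p1: "1 \<le> p" and f: "f \<in> Leb p"
    and lim: "(\<lambda>k. real (M k) powr a * vilenkin_modulus m p (k - 1) f) \<longlonglongrightarrow> 0"
  shows "(\<lambda>n. N p (\<lambda>x. cesaro_mean m (- a) n f x - f x)) \<longlonglongrightarrow> 0"
proof -
  define b where "b k = real (M k) powr a * vilenkin_modulus m p (k - 1) f" for k
  define err where "err n = N p (\<lambda>x. cesaro_mean m (- a) n f x - f x)" for n
  have b0: "0 \<le> b k" for k unfolding b_def using modulus_nonneg[OF p1 f] by simp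
  have err0: "0 \<le> err n" for n
    unfolding err_def cesaro_mean_eq_multiplier
    by (intro N_nonneg[OF p1] Leb_diff[OF p1] multiplier_in_Leb[OF p1 f] f)
  have "Bseq b" using lim unfolding b_def[abs_def] by (intro convergent_imp_Bseq convergentI)
  then obtain W where W: "0 < W" "\<And>k. b k \<le> W" using b0 by (auto simp: Bseq_def)
  obtain C where C: "0 < C"
    "\<And>p f n K. \<lbrakk>1 \<le> p; f \<in> Leb p; 2 * M K \<le> n\<rbrakk> \<Longrightarrow>
      N p (\<lambda>x. cesaro_mean m (- a) n f x - f x)
        \<le> (C * real (n + 1) powr a + 1) * vilenkin_modulus m p K f
          + (\<Sum>j<K. C * real (M (Suc j)) powr (1 + a / 2) / real (n + 1) * vilenkin_modulus m p j f)"
    by (rule N_cesaro_error_le[OF a]) blast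
  define r where "r = 2 powr (- a / 4)"
  have r: "0 < r" "r < 1" using a by (auto simp: r_def powr_less_one)
  define D1 where "D1 = C * B + 1"
  define D2 where "D2 = C * W / (1 - r)"
  have D1: "0 < D1" using C by (simp add: D1_def add_nonneg_pos)
  have D2: "0 \<le> D2" using C W r by (simp add: D2_def)
  have bound: "err n \<le> D1 * b k + D2 * real (n + 1) powr (- a / 4)"
    if k: "1 \<le> k" "M k \<le> n" "n < M (Suc k)" for n k
  proof -
    define K where "K = k - 1"
    have kK: "k = Suc K" using k by (simp add: K_def)
    have n: "2 * M K \<le> n" using M_Suc_ge[of K] k unfolding kK by linarith
    have Mk: "1 \<le> real (M k) powr a" using M_pos[of k] a by (intro ge_one_powr_ge_zero) (auto simp del: M_pos)
    have om0: "0 \<le> vilenkin_modulus m p j f" for j by (rule modulus_nonneg[OF p1 f])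
    have first: "(C * real (n + 1) powr a + 1) * vilenkin_modulus m p K f \<le> D1 * b k"
    proof -
      have "real (n + 1) \<le> real (B * M k)"
        using k m_le_B[of k] by (intro of_nat_mono order_trans[OF _ mult_right_mono[OF m_le_B[of k]]]) auto
      then have "real (n + 1) powr a \<le> (real B * real (M k)) powr a"
        using a by (intro powr_mono2) auto
      also have "\<dots> = real B powr a * real (M k) powr a" by (rule powr_mult)
      also have "\<dots> \<le> real B powr 1 * real (M k) powr a"
        using a B_pos by (intro mult_right_mono powr_mono) auto
      finally have "C * real (n + 1) powr a + 1 \<le> C * (real B * real (M k) powr a) + real (M k) powr a"
        using C Mk by (intro add_mono mult_left_mono) auto
      also have "\<dots> = D1 * real (M k) powr a" by (simp add: D1_def algebra_simps)
      finally show ?thesis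
        using mult_right_mono[OF _ om0[of K]] by (fastforce simp: b_def kK mult.assoc)
    qed
    have band: "C * real (M (Suc j)) powr (1 + a / 2) / real (n + 1) * vilenkin_modulus m p j f
        \<le> C * W * real (n + 1) powr (- a / 4) * r ^ j" if j: "j < K" for j
    proof -
      define x where "x = real (M (Suc j))"
      define y where "y = real (n + 1)"
      have x: "1 \<le> x" using M_pos[of "Suc j"] unfolding x_def by linarith
      have "M (Suc j) \<le> M k" using j kK by (intro M_mono) simp
      then have xy: "x \<le> y" unfolding x_def y_def using k by (intro of_nat_mono) linarith
      have "vilenkin_modulus m p j f * x powr a \<le> W"
        using W(2)[of "Suc j"] by (simp add: b_def x_def mult.commute)
      then have om: "vilenkin_modulus m p j f \<le> W * x powr (- a)"
        using x by (simp add: powr_minus field_simps)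
      \<comment> \<open>Of the surplus \<open>x powr (- a / 2)\<close> one half makes the sum over the bands geometric; the other half,
        with \<open>x \<le> y\<close>, is traded for decay in \<open>n\<close>.\<close>
      have "x powr (1 + a / 2) / y * vilenkin_modulus m p j f \<le> x powr (1 + a / 2) / y * (W * x powr (- a))"
        using om xy x by (intro mult_left_mono) auto
      also have "\<dots> = W * (x powr (- a / 4) * x powr (1 - a / 4)) / y"
      proof -
        have "x powr (1 + a / 2) * x powr (- a) = x powr (- a / 4) * x powr (1 - a / 4)"
          unfolding powr_add[symmetric] by (rule arg_cong[where f = "\<lambda>t. x powr t"]) (simp add: field_simps)
        then show ?thesis by simp
      qed
      also have "\<dots> \<le> W * (r ^ j * y powr (1 - a / 4)) / y"
      proof (intro divide_right_mono mult_left_mono mult_mono)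
        have "2 ^ j \<le> M (Suc j)" by (rule order_trans[OF M_ge_pow M_mono]) simp
        then have "real (2 ^ j) \<le> x" unfolding x_def by (rule of_nat_mono)
        then have "2 ^ j \<le> x" by simp
        then have "x powr (- a / 4) \<le> (2 ^ j) powr (- a / 4)"
          using a by (intro powr_mono2') auto
        also have "\<dots> = r ^ j"
          unfolding r_def by (simp add: powr_powr mult.commute flip: powr_realpow)
        finally show "x powr (- a / 4) \<le> r ^ j" .
        show "x powr (1 - a / 4) \<le> y powr (1 - a / 4)" using x xy a by (intro powr_mono2) auto
      qed (use W r x xy in auto)
      also have "\<dots> = W * y powr (- a / 4) * r ^ j"
      proof -
        have "y powr (1 - a / 4) = y * y powr (- a / 4)" using x xy by (simp add: powr_mult_base)
        then show ?thesis using x xy by simp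
      qed
      finally have "C * (x powr (1 + a / 2) / y * vilenkin_modulus m p j f) \<le> C * (W * y powr (- a / 4) * r ^ j)"
        using C by (intro mult_left_mono) auto
      then show ?thesis by (simp add: x_def y_def mult.assoc)
    qed
    have "err n \<le> (C * real (n + 1) powr a + 1) * vilenkin_modulus m p K f
          + (\<Sum>j<K. C * real (M (Suc j)) powr (1 + a / 2) / real (n + 1) * vilenkin_modulus m p j f)"
      unfolding err_def by (rule C(2)[OF p1 f n])
    also have "\<dots> \<le> D1 * b k + (\<Sum>j<K. C * W * real (n + 1) powr (- a / 4) * r ^ j)"
      by (intro add_mono first sum_mono band) simp
    also have "(\<Sum>j<K. C * W * real (n + 1) powr (- a / 4) * r ^ j)
        \<le> C * W * real (n + 1) powr (- a / 4) * (1 / (1 - r))"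
    proof -
      have "(\<Sum>j<K. r ^ j) \<le> (\<Sum>j. r ^ j)"
        using r by (intro sum_le_suminf summable_geometric) auto
      also have "\<dots> = 1 / (1 - r)" using r by (intro suminf_geometric) simp
      finally show ?thesis
        unfolding sum_distrib_left[symmetric] using C W by (intro mult_left_mono) auto
    qed
    also have "\<dots> = D2 * real (n + 1) powr (- a / 4)" by (simp add: D2_def)
    finally show ?thesis by simp
  qed
  have pow0: "(\<lambda>n. D2 * real (n + 1) powr (- a / 4)) \<longlonglongrightarrow> 0"
  proof -
    have "(\<lambda>n. real (n + 1) powr (- (a / 4))) \<longlonglongrightarrow> 0"
      using a by (intro tendsto_neg_powr filterlim_compose[OF filterlim_real_sequentially] filterlim_add_const_nat_at_top) auto
    from tendsto_mult_right_zero[OF this, of D2] show ?thesis by simp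
  qed
  show ?thesis
    unfolding err_def[symmetric]
  proof (rule LIMSEQ_I)
    fix e :: real assume e: "0 < e"
    have "eventually (\<lambda>k. b k < e / (2 * D1)) sequentially"
      using lim e D1 unfolding b_def[abs_def] by (intro order_tendstoD(2)) auto
    then obtain k0 where k0: "\<And>k. k0 \<le> k \<Longrightarrow> b k < e / (2 * D1)"
      by (auto simp: eventually_sequentially)
    have "eventually (\<lambda>n. D2 * real (n + 1) powr (- a / 4) < e / 2) sequentially"
      using pow0 e by (intro order_tendstoD(2)) auto
    then obtain n0 where n0: "\<And>n. n0 \<le> n \<Longrightarrow> D2 * real (n + 1) powr (- a / 4) < e / 2"
      by (auto simp: eventually_sequentially)
    show "\<exists>no. \<forall>n\<ge>no. norm (err n - 0) < e"
    proof (intro exI allI impI)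
      fix n assume n: "max n0 (M (Suc k0)) \<le> n"
      then have "0 < n" using M_pos[of "Suc k0"] by linarith
      then obtain k where k: "M k \<le> n" "n < M (Suc k)" using ex_M_interval by blast
      have "Suc k0 \<le> k"
      proof (rule ccontr)
        assume "\<not> Suc k0 \<le> k"
        then have "M (Suc k) \<le> M (Suc k0)" by (intro M_mono) simp
        then show False using n k by linarith
      qed
      then have "b k < e / (2 * D1)" by (intro k0) simp
      then have "D1 * b k < e / 2" using D1 by (simp add: field_simps)
      moreover have "err n \<le> D1 * b k + D2 * real (n + 1) powr (- a / 4)"
        by (rule bound) (use k \<open>Suc k0 \<le> k\<close> in auto)
      moreover have "D2 * real (n + 1) powr (- a / 4) < e / 2" by (rule n0) (use n in simp)
      ultimately show "norm (err n - 0) < e" using err0[of n] by simp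
    qed
  qed
qed

end

theorem corollary1:
  fixes m :: "nat \<Rightarrow> nat" and p :: ennreal and \<alpha> :: real
    and f :: "(nat \<Rightarrow> int) \<Rightarrow> complex"
  assumes "\<forall>k. m k \<ge> 2" and "\<exists>B. \<forall>k. m k \<le> B"
    and "1 \<le> p"
    and "0 < \<alpha>" and "\<alpha> < 1"
    and "f \<in> vilenkin_Lp m p"
    and "(\<lambda>k. real (vilenkin_M m k) powr \<alpha> * vilenkin_modulus m p (k - 1) f) \<longlonglongrightarrow> 0"
  shows "(\<lambda>n. vilenkin_norm m p (\<lambda>x. cesaro_mean m (- \<alpha>) n f x - f x)) \<longlonglongrightarrow> 0"
proof -
  obtain B where B: "\<forall>k. m k \<le> B" using assms(2) by blast
  interpret bounded_vilenkin m B
    by unfold_locales (use assms(1) B in auto)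
  show ?thesis
    by (rule cesaro_mean_tendsto[OF assms(4,5,3) Leb_of_Lp[OF assms(6)] assms(7)])
qed

end
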